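(* Let $G$ be a digraph. The following properties are equivalent: 1. $G$ is an oriented threshold graph. 2. $G$ is an oriented co-trivially perfect graph. 3. $G\in\mathrm{Free}(\{D_1,D_5,D_8,D_{12},2\overrightarrow{P_2},\overleftrightarrow{K_2}\})$. 4. $G\in\mathrm{Free}(\{D_1,D_5,\overleftrightarrow{K_2}\})$ and $\mathrm{un}(G)\in\mathrm{Free}(\{2K_2,C_4,P_4\})$. 5. $G\in\mathrm{Free}(\{D_1,D_5,\overleftrightarrow{K_2}\})$ and $\mathrm{un}(G)$ is a threshold graph. 6. $G\in\mathrm{Free}(\{D_1,D_5,D_{12},\overleftrightarrow{K_2}\})$ and $\mathrm{un}(G)\in\mathrm{Free}(\{P_4,2K_2\})$. 7. $G\in\mathrm{Free}(\{D_1,D_5,D_{12},\overleftrightarrow{K_2}\})$ and $\mathrm{un}(G)$ is a co-trivially perfect graph. 8. $G\in\mathrm{Free}(\{D_1,D_5,D_{12},2\overrightarrow{P_2},\overleftrightarrow{K_2}\})$ and $\mathrm{un}(G)\in\mathrm{Free}(\{P_4\})$. 9. $G\in\mathrm{Free}(\{D_1,D_5,D_{12},2\overrightarrow{P_2},\overleftrightarrow{K_2}\})$ and $\mathrm{un}(G)$ is a co-graph. 10. $G$ is transitive and $G\in\mathrm{Free}(\{D_8,D_{12},2\overrightarrow{P_2},\overleftrightarrow{K_2}\})$.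
   Context: Digraphs $G=(V,E)$ are finite with nonempty vertex set and $E\subseteq\{(u,v): u,v\in V,\ u\neq v\}$ (no loops, no multiple arcs; both $(u,v)$ and $(v,u)$ may be present). Undirected graphs are finite, simple and nonempty. All classes are closed under isomorphism. For a set $F$ of (di)graphs, $\mathrm{Free}(F)$ is the class of all (di)graphs having no induced sub(di)graph isomorphic to a member of $F$. The underlying graph $\mathrm{un}(G)$ of $G=(V,E)$ has vertex set $V$ and edge set $\{\{u,v\}:(u,v)\in E\}$. A digraph $G=(V,E)$ is transitive if for all arcs $(u,v),(v,w)\in E$ with $u\neq w$ also $(u,w)\in E$. Operations on vertex-disjoint digraphs $G_1=(V_1,E_1)$, $G_2=(V_2,E_2)$: each result has vertex set $V_1\cup V_2$; $G_1\oplus G_2$ has arc set $E_1\cup E_2$; $G_1\oslash G_2$ has arc set $E_1\cup E_2\cup\{(u,v):u\in V_1,v\in V_2\}$. The symbol $\bullet$ is a one-vertex digraph. Oriented threshold graphs: the smallest class containing every one-vertex digraph and containing $G\oplus\bullet$, $G\oslash\bullet$, $\bullet\oslash G$ whenever it contains $G$. Oriented co-trivially perfect graphs: the smallest class containing every one-vertex digraph and containing $G\oslash\bullet$, $\bullet\oslash G$, $G\oplus\bullet$ whenever it contains $G$ (the defining rules of the two classes coincide). Undirected classes, each the smallest class containing the one-vertex graphs with the indicated closure (the join of two vertex-disjoint graphs is their disjoint union plus all edges between them): co-graphs: closed under disjoint union and join of two members; co-trivially perfect graphs: closed under join of two members and under adding an isolated vertex; threshold graphs: closed under adding an isolated vertex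 and under adding a vertex adjacent to all existing vertices. $P_4$ is the path and $C_4$ the cycle on 4 vertices; $2K_2$ is the disjoint union of two edges. Special digraphs: $\overleftrightarrow{K_2}$ has two vertices and both arcs between them; $2\overrightarrow{P_2}$ is the disjoint union of two single arcs (vertices $a,b,c,d$, arcs $(a,b),(c,d)$). $D_1$: vertices $a,b,c$, arcs $(a,b),(b,c)$. $D_5$: the directed cycle $(a,b),(b,c),(c,a)$. $D_8$: vertices $a,b,c,d$, arcs $(a,b),(c,b),(c,d)$. $D_{12}$: vertices $a,b,c,d$, arcs $(a,c),(a,d),(b,c),(b,d)$. *)

theory Defs
  imports "Graph_Theory.Pair_Digraph" "Graph_Theory.Digraph_Isomorphism"
begin

section \<open>Digraphs\<close>

text \<open>The locale predicate \<^const>\<open>pair_digraph\<close> admits the null digraph, so nonemptiness is added.\<close>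

definition nonempty_digraph :: "'a pair_pre_digraph \<Rightarrow> bool" where
  "nonempty_digraph G \<longleftrightarrow> pair_digraph G \<and> pverts G \<noteq> {}"

definition digraph_Free :: "'b pair_pre_digraph set \<Rightarrow> 'a pair_pre_digraph set" where
  "digraph_Free F = {G. nonempty_digraph G \<and>
     \<not> (\<exists>H. induced_subgraph (with_proj H) (with_proj G) \<and>
            (\<exists>D\<in>F. digraph_iso (with_proj H) (with_proj D)))}"

definition transitive_digraph :: "'a pair_pre_digraph \<Rightarrow> bool" where
  "transitive_digraph G \<longleftrightarrow>
     (\<forall>u v w. (u, v) \<in> parcs G \<and> (v, w) \<in> parcs G \<and> u \<noteq> w \<longrightarrow> (u, w) \<in> parcs G)"

text \<open>The two operations are meant for vertex-disjoint arguments; they are only applied to such.\<close>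

definition digraph_disj_union ::
    "'a pair_pre_digraph \<Rightarrow> 'a pair_pre_digraph \<Rightarrow> 'a pair_pre_digraph" (infixl "\<oplus>" 65) where
  "G \<oplus> H = \<lparr>pverts = pverts G \<union> pverts H, parcs = parcs G \<union> parcs H\<rparr>"

definition digraph_order_comp ::
    "'a pair_pre_digraph \<Rightarrow> 'a pair_pre_digraph \<Rightarrow> 'a pair_pre_digraph" (infixl "\<oslash>" 65) where
  "G \<oslash> H = \<lparr>pverts = pverts G \<union> pverts H,
            parcs = parcs G \<union> parcs H \<union> pverts G \<times> pverts H\<rparr>"

definition digraph_point :: "'a \<Rightarrow> 'a pair_pre_digraph" where
  "digraph_point v = \<lparr>pverts = {v}, parcs = {}\<rparr>"

text \<open>
  In the inductive classes below, the one-vertex (di)graph ranges over all vertices \<open>v\<close>, and the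
  added vertex over all fresh ones; this makes the classes closed under isomorphism.
\<close>

inductive oriented_threshold :: "'a pair_pre_digraph \<Rightarrow> bool" where
  point: "oriented_threshold (digraph_point v)"
| isolated: "oriented_threshold G \<Longrightarrow> v \<notin> pverts G \<Longrightarrow> oriented_threshold (G \<oplus> digraph_point v)"
| sink: "oriented_threshold G \<Longrightarrow> v \<notin> pverts G \<Longrightarrow> oriented_threshold (G \<oslash> digraph_point v)"
| source: "oriented_threshold G \<Longrightarrow> v \<notin> pverts G \<Longrightarrow> oriented_threshold (digraph_point v \<oslash> G)"

inductive oriented_co_trivially_perfect :: "'a pair_pre_digraph \<Rightarrow> bool" where
  point: "oriented_co_trivially_perfect (digraph_point v)"
| sink: "oriented_co_trivially_perfect G \<Longrightarrow> v \<notin> pverts G \<Longrightarrow>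
    oriented_co_trivially_perfect (G \<oslash> digraph_point v)"
| source: "oriented_co_trivially_perfect G \<Longrightarrow> v \<notin> pverts G \<Longrightarrow>
    oriented_co_trivially_perfect (digraph_point v \<oslash> G)"
| isolated: "oriented_co_trivially_perfect G \<Longrightarrow> v \<notin> pverts G \<Longrightarrow>
    oriented_co_trivially_perfect (G \<oplus> digraph_point v)"

definition bidirected_K2 :: "nat pair_pre_digraph" where
  "bidirected_K2 = \<lparr>pverts = {0, 1}, parcs = {(0, 1), (1, 0)}\<rparr>"

definition two_directed_P2 :: "nat pair_pre_digraph" where
  "two_directed_P2 = \<lparr>pverts = {0, 1, 2, 3}, parcs = {(0, 1), (2, 3)}\<rparr>"

definition D1 :: "nat pair_pre_digraph" where
  "D1 = \<lparr>pverts = {0, 1, 2}, parcs = {(0, 1), (1, 2)}\<rparr>"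

definition D5 :: "nat pair_pre_digraph" where
  "D5 = \<lparr>pverts = {0, 1, 2}, parcs = {(0, 1), (1, 2), (2, 0)}\<rparr>"

definition D8 :: "nat pair_pre_digraph" where
  "D8 = \<lparr>pverts = {0, 1, 2, 3}, parcs = {(0, 1), (2, 1), (2, 3)}\<rparr>"

definition D12 :: "nat pair_pre_digraph" where
  "D12 = \<lparr>pverts = {0, 1, 2, 3}, parcs = {(0, 2), (0, 3), (1, 2), (1, 3)}\<rparr>"

section \<open>Undirected graphs\<close>

text \<open>
  The library encodes undirected graphs as symmetric digraphs; here an edge is literally a
  two-element vertex set.
\<close>

record 'a ugraph =
  uverts :: "'a set"
  uedges :: "'a set set"

definition simple_ugraph :: "'a ugraph \<Rightarrow> bool" where
  "simple_ugraph G \<longleftrightarrow> finite (uverts G) \<and> uverts G \<noteq> {} \<and>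
     uedges G \<subseteq> {{u, v} | u v. u \<in> uverts G \<and> v \<in> uverts G \<and> u \<noteq> v}"

definition un :: "'a pair_pre_digraph \<Rightarrow> 'a ugraph" where
  "un G = \<lparr>uverts = pverts G, uedges = {{u, v} | u v. (u, v) \<in> parcs G}\<rparr>"

definition ugraph_induced :: "'a ugraph \<Rightarrow> 'a ugraph \<Rightarrow> bool" where
  "ugraph_induced H G \<longleftrightarrow> uverts H \<subseteq> uverts G \<and> uedges H = {e \<in> uedges G. e \<subseteq> uverts H}"

definition ugraph_iso :: "'a ugraph \<Rightarrow> 'b ugraph \<Rightarrow> bool" where
  "ugraph_iso G H \<longleftrightarrow>
     (\<exists>f. bij_betw f (uverts G) (uverts H) \<and> uedges H = (\<lambda>e. f ` e) ` uedges G)"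

definition ugraph_Free :: "'b ugraph set \<Rightarrow> 'a ugraph set" where
  "ugraph_Free F = {G. simple_ugraph G \<and>
     \<not> (\<exists>H. ugraph_induced H G \<and> (\<exists>D\<in>F. ugraph_iso H D))}"

definition ugraph_disj_union :: "'a ugraph \<Rightarrow> 'a ugraph \<Rightarrow> 'a ugraph" where
  "ugraph_disj_union G H = \<lparr>uverts = uverts G \<union> uverts H, uedges = uedges G \<union> uedges H\<rparr>"

definition ugraph_join :: "'a ugraph \<Rightarrow> 'a ugraph \<Rightarrow> 'a ugraph" where
  "ugraph_join G H = \<lparr>uverts = uverts G \<union> uverts H,
     uedges = uedges G \<union> uedges H \<union> {{u, v} | u v. u \<in> uverts G \<and> v \<in> uverts H}\<rparr>"

definition ugraph_point :: "'a \<Rightarrow> 'a ugraph" where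
  "ugraph_point v = \<lparr>uverts = {v}, uedges = {}\<rparr>"

inductive cograph :: "'a ugraph \<Rightarrow> bool" where
  point: "cograph (ugraph_point v)"
| disj_union: "cograph G \<Longrightarrow> cograph H \<Longrightarrow> uverts G \<inter> uverts H = {} \<Longrightarrow>
    cograph (ugraph_disj_union G H)"
| join: "cograph G \<Longrightarrow> cograph H \<Longrightarrow> uverts G \<inter> uverts H = {} \<Longrightarrow> cograph (ugraph_join G H)"

inductive co_trivially_perfect :: "'a ugraph \<Rightarrow> bool" where
  point: "co_trivially_perfect (ugraph_point v)"
| join: "co_trivially_perfect G \<Longrightarrow> co_trivially_perfect H \<Longrightarrow> uverts G \<inter> uverts H = {} \<Longrightarrow>
    co_trivially_perfect (ugraph_join G H)"
| isolated: "co_trivially_perfect G \<Longrightarrow> v \<notin> uverts G \<Longrightarrow>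
    co_trivially_perfect (ugraph_disj_union G (ugraph_point v))"

inductive threshold_graph :: "'a ugraph \<Rightarrow> bool" where
  point: "threshold_graph (ugraph_point v)"
| isolated: "threshold_graph G \<Longrightarrow> v \<notin> uverts G \<Longrightarrow>
    threshold_graph (ugraph_disj_union G (ugraph_point v))"
| dominating: "threshold_graph G \<Longrightarrow> v \<notin> uverts G \<Longrightarrow>
    threshold_graph (ugraph_join G (ugraph_point v))"

definition P4 :: "nat ugraph" where
  "P4 = \<lparr>uverts = {0, 1, 2, 3}, uedges = {{0, 1}, {1, 2}, {2, 3}}\<rparr>"

definition C4 :: "nat ugraph" where
  "C4 = \<lparr>uverts = {0, 1, 2, 3}, uedges = {{0, 1}, {1, 2}, {2, 3}, {3, 0}}\<rparr>"

definition two_K2 :: "nat ugraph" where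
  "two_K2 = \<lparr>uverts = {0, 1, 2, 3}, uedges = {{0, 1}, {2, 3}}\<rparr>"

end

theory Submission
  imports Defs
begin

text \<open>
  Excluding the bidirected edge, \<open>D1\<close> and \<open>D5\<close> says exactly that the arc relation is asymmetric and
  transitive. For such a digraph \<open>D8\<close>, \<open>D12\<close> and \<open>2P2\<close> are the only transitive orientations of
  \<open>P4\<close>, \<open>C4\<close> and \<open>2K2\<close>, so every characterization reduces to: asymmetric, transitive, and none of
  these three induced subgraphs in the underlying graph. The absence of all three makes
  neighbourhoods nested, which yields an isolated or dominating vertex; with transitivity, a
  dominating vertex can be replaced by a dominating source or sink, and induction on the number of
  vertices applies.
\<close>

section \<open>Induced subgraphs as embeddings\<close>

text \<open>The orientation is rigid because in an induced path on \<open>a\<close>,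
  \<open>b\<close>, \<open>c\<close> the middle vertex must be a source or a sink: otherwise
  transitivity supplies the missing edge between \<open>a\<close> and \<open>c\<close>. Orienting
  one edge of an induced \<open>P4\<close> or \<open>C4\<close> thus orients all its edges, and the
  two outcomes are isomorphic. For the three undirected classes, induction is used only to show that
  their members avoid the patterns. Membership in the opposite direction comes from the orientation:
  each construction step of an oriented threshold graph projects to a threshold step, and threshold
  graphs are co-trivially perfect, which in turn are co-graphs. So each class condition is
  sandwiched between being an oriented threshold graph and a pattern-free condition. Induced copies
  are first turned into injective maps from the pattern into the host, and then into statements
  about two to four named vertices.\<close>

definition embeds_in :: "'b pair_pre_digraph \<Rightarrow> 'a pair_pre_digraph \<Rightarrow> bool" where
  "embeds_in D G \<longleftrightarrow> (\<exists>f. inj_on f (pverts D) \<and> f ` pverts D \<subseteq> pverts G \<and>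
     (\<forall>x\<in>pverts D. \<forall>y\<in>pverts D. (x, y) \<in> parcs D \<longleftrightarrow> (f x, f y) \<in> parcs G))"

text \<open>A library isomorphism has separate vertex and arc maps and may rename head and tail.
  Since both sides come from \<open>with_proj\<close>, tail and head are the projections, so the
  vertex map determines the arc map and only an injection on vertices remains.\<close>

lemma embeds_in_iff:
  assumes G: "pair_wf_digraph G" and D: "pair_wf_digraph D"
  shows "(\<exists>H. induced_subgraph (with_proj H) (with_proj G) \<and>
            digraph_iso (with_proj H) (with_proj D)) \<longleftrightarrow> embeds_in D G"
proof
  assume "\<exists>H. induced_subgraph (with_proj H) (with_proj G) \<and>
            digraph_iso (with_proj H) (with_proj D)"
  then obtain H h where sub: "pverts H \<subseteq> pverts G"
    and arcs: "parcs H = {e \<in> parcs G. fst e \<in> pverts H \<and> snd e \<in> pverts H}"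
    and iso: "pre_digraph.digraph_isomorphism (with_proj H) h"
    and D_eq: "with_proj D = app_iso h (with_proj H)"
    by (auto simp: induced_subgraph_def subgraph_def digraph_iso_def)
  define g where "g = iso_verts h"
  have inj: "inj_on g (pverts H)"
    using iso by (simp add: pre_digraph.digraph_isomorphism_def g_def)
  have verts_D: "pverts D = g ` pverts H" and arcs_D: "parcs D = iso_arcs h ` parcs H"
    and tail: "iso_tail h = fst" and head: "iso_head h = snd"
    using D_eq by (simp_all add: with_proj_def app_iso_def g_def)
  have arc: "iso_arcs h a = (g (fst a), g (snd a))" if "a \<in> parcs H" for a
    using iso that by (simp add: pre_digraph.digraph_isomorphism_def tail head g_def prod_eq_iff)
  \<comment> \<open>The isomorphism runs from the subdigraph to the pattern, the embedding the other
    way, hence the inverse.\<close>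
  define f where "f = the_inv_into (pverts H) g"
  have fg: "f (g x) = x" if "x \<in> pverts H" for x
    using inj that by (simp add: f_def the_inv_into_f_f)
  have "(g x, g y) \<in> parcs D \<longleftrightarrow> (x, y) \<in> parcs G" if "x \<in> pverts H" "y \<in> pverts H" for x y
  proof
    assume "(g x, g y) \<in> parcs D"
    then obtain a where a: "a \<in> parcs H" "g x = g (fst a)" "g y = g (snd a)"
      using arcs_D arc by auto
    moreover have "fst a \<in> pverts H" "snd a \<in> pverts H" "a \<in> parcs G"
      using a arcs by auto
    ultimately show "(x, y) \<in> parcs G"
      using inj that by (metis inj_onD prod.collapse)
  next
    assume "(x, y) \<in> parcs G"
    then have "(x, y) \<in> parcs H" using that arcs by simp
    then show "(g x, g y) \<in> parcs D" using arcs_D arc by force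
  qed
  then have "inj_on f (pverts D) \<and> f ` pverts D \<subseteq> pverts G \<and>
     (\<forall>x\<in>pverts D. \<forall>y\<in>pverts D. (x, y) \<in> parcs D \<longleftrightarrow> (f x, f y) \<in> parcs G)"
    using sub fg by (auto simp: verts_D inj_on_def)
  then show "embeds_in D G" unfolding embeds_in_def by blast
next
  assume "embeds_in D G"
  then obtain f where inj: "inj_on f (pverts D)" and into: "f ` pverts D \<subseteq> pverts G"
    and arcs: "\<And>x y. x \<in> pverts D \<Longrightarrow> y \<in> pverts D \<Longrightarrow>
      (x, y) \<in> parcs D \<longleftrightarrow> (f x, f y) \<in> parcs G"
    unfolding embeds_in_def by blast
  define H where "H = \<lparr>pverts = f ` pverts D,
    parcs = {e \<in> parcs G. fst e \<in> f ` pverts D \<and> snd e \<in> f ` pverts D}\<rparr>"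
  define g where "g = the_inv_into (pverts D) f"
  have gf: "g (f x) = x" if "x \<in> pverts D" for x
    using inj that by (simp add: g_def the_inv_into_f_f)
  have D_verts: "x \<in> pverts D" "y \<in> pverts D" if "(x, y) \<in> parcs D" for x y
    using D that by (auto dest: pair_wf_digraph.in_arcsD1 pair_wf_digraph.in_arcsD2)
  \<comment> \<open>Arcs are pairs, so the arc map induced by \<open>g\<close> is
    \<open>map_prod g g\<close>.\<close>
  define h where "h = \<lparr>iso_verts = g, iso_arcs = map_prod g g, iso_head = snd, iso_tail = fst\<rparr>"
  have H: "pair_wf_digraph H"
    by unfold_locales (auto simp: H_def)
  have ind: "induced_subgraph (with_proj H) (with_proj G)"
    using into G H
    by (auto simp: induced_subgraph_def subgraph_def wf_digraph_wp_iff compatible_def H_def)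
  have inj_g: "inj_on g (pverts H)"
    by (auto simp: inj_on_def H_def gf)
  have parcs_D: "parcs D = map_prod g g ` parcs H"
  proof (intro equalityI subsetI)
    fix e assume "e \<in> parcs D"
    then obtain x y where e: "e = (x, y)" "(x, y) \<in> parcs D" by (cases e) auto
    then have "(f x, f y) \<in> parcs H" "e = map_prod g g (f x, f y)"
      using D_verts[OF e(2)] arcs[of x y] gf[of x] gf[of y] by (simp_all add: H_def)
    then show "e \<in> map_prod g g ` parcs H" by blast
  next
    fix e assume "e \<in> map_prod g g ` parcs H"
    then show "e \<in> parcs D" using arcs gf by (auto simp: H_def)
  qed
  have "inj_on (map_prod g g) (parcs H)"
    using inj_g by (auto simp: inj_on_def H_def)
  then have "pre_digraph.digraph_isomorphism (with_proj H) h"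
    using inj_g H
    by (simp add: pre_digraph.digraph_isomorphism_def wf_digraph_wp_iff h_def)
  moreover have "with_proj D = app_iso h (with_proj H)"
    using parcs_D gf by (force simp: with_proj_def app_iso_def h_def H_def image_image)
  ultimately show "\<exists>H. induced_subgraph (with_proj H) (with_proj G) \<and>
            digraph_iso (with_proj H) (with_proj D)"
    using ind by (auto simp: digraph_iso_def)
qed

lemma digraph_Free_iff:
  assumes "nonempty_digraph G" "\<forall>D\<in>F. pair_wf_digraph D"
  shows "G \<in> digraph_Free F \<longleftrightarrow> (\<forall>D\<in>F. \<not> embeds_in D G)"
proof -
  have "pair_wf_digraph G"
    using assms(1) by (simp add: nonempty_digraph_def pair_digraph_def pair_fin_digraph_def)
  then show ?thesis
    using assms embeds_in_iff[of G] unfolding digraph_Free_def by blast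
qed

section \<open>Induced subgraphs of undirected graphs\<close>

definition adj :: "'a ugraph \<Rightarrow> 'a \<Rightarrow> 'a \<Rightarrow> bool" where
  "adj U u v \<longleftrightarrow> {u, v} \<in> uedges U"

lemma adj_sym: "adj U u v \<Longrightarrow> adj U v u"
  by (simp add: adj_def insert_commute)

lemma simple_ugraph_adjD:
  assumes "simple_ugraph U" "adj U u v"
  shows "u \<in> uverts U" "v \<in> uverts U" "u \<noteq> v"
  using assms by (auto simp: simple_ugraph_def adj_def doubleton_eq_iff)

text \<open>The diagonal case \<open>x = y\<close> is harmless: \<open>adj U u u\<close> would make
  a singleton an edge, which fails in simple graphs on both sides.\<close>

definition embeds_in_ugraph :: "'b ugraph \<Rightarrow> 'a ugraph \<Rightarrow> bool" where
  "embeds_in_ugraph D U \<longleftrightarrow> (\<exists>f. inj_on f (uverts D) \<and> f ` uverts D \<subseteq> uverts U \<and>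
     (\<forall>x\<in>uverts D. \<forall>y\<in>uverts D. adj D x y \<longleftrightarrow> adj U (f x) (f y)))"

lemma embeds_in_ugraph_iff:
  assumes U: "simple_ugraph U" and D: "simple_ugraph D"
  shows "(\<exists>H. ugraph_induced H U \<and> ugraph_iso H D) \<longleftrightarrow> embeds_in_ugraph D U"
proof
  assume "\<exists>H. ugraph_induced H U \<and> ugraph_iso H D"
  then obtain H where H: "ugraph_induced H U" "ugraph_iso H D" by blast
  from H(1) have sub: "uverts H \<subseteq> uverts U"
    and edges: "uedges H = {e \<in> uedges U. e \<subseteq> uverts H}"
    by (simp_all add: ugraph_induced_def)
  from H(2) obtain g where bij: "bij_betw g (uverts H) (uverts D)"
    and edges_D: "uedges D = (\<lambda>e. g ` e) ` uedges H"
    unfolding ugraph_iso_def by blast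
  have inj: "inj_on g (uverts H)" and verts_D: "uverts D = g ` uverts H"
    using bij by (auto simp: bij_betw_def)
  define f where "f = the_inv_into (uverts H) g"
  have fg: "f (g x) = x" if "x \<in> uverts H" for x
    using inj that by (simp add: f_def the_inv_into_f_f)
  have "adj D (g x) (g y) \<longleftrightarrow> adj U x y" if xy: "x \<in> uverts H" "y \<in> uverts H" for x y
  proof
    assume "adj D (g x) (g y)"
    then obtain e where e: "e \<in> uedges H" "g ` e = g ` {x, y}"
      by (auto simp: adj_def edges_D)
    moreover have "e \<subseteq> uverts H" "{x, y} \<subseteq> uverts H"
      using e edges xy by auto
    ultimately have "e = {x, y}" using inj by (metis inj_on_image_eq_iff)
    then show "adj U x y" using e edges by (simp add: adj_def)
  next
    assume "adj U x y"
    then have "{x, y} \<in> uedges H" using xy edges by (simp add: adj_def)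
    then have "g ` {x, y} \<in> uedges D" using edges_D by blast
    then show "adj D (g x) (g y)" by (simp add: adj_def)
  qed
  then have "inj_on f (uverts D) \<and> f ` uverts D \<subseteq> uverts U \<and>
     (\<forall>x\<in>uverts D. \<forall>y\<in>uverts D. adj D x y \<longleftrightarrow> adj U (f x) (f y))"
    using sub fg by (auto simp: verts_D inj_on_def)
  then show "embeds_in_ugraph D U" unfolding embeds_in_ugraph_def by blast
next
  assume "embeds_in_ugraph D U"
  then obtain f where inj: "inj_on f (uverts D)" and into: "f ` uverts D \<subseteq> uverts U"
    and adj: "\<And>x y. x \<in> uverts D \<Longrightarrow> y \<in> uverts D \<Longrightarrow> adj D x y \<longleftrightarrow> adj U (f x) (f y)"
    unfolding embeds_in_ugraph_def by blast
  define H where "H = \<lparr>uverts = f ` uverts D, uedges = {e \<in> uedges U. e \<subseteq> f ` uverts D}\<rparr>"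
  define g where "g = the_inv_into (uverts D) f"
  have gf: "g (f x) = x" if "x \<in> uverts D" for x
    using inj that by (simp add: g_def the_inv_into_f_f)
  have "ugraph_induced H U" using into by (auto simp: ugraph_induced_def H_def)
  moreover have "bij_betw g (uverts H) (uverts D)"
    by (auto simp: bij_betw_def inj_on_def H_def gf image_image)
  moreover have "uedges D = (\<lambda>e. g ` e) ` uedges H"
  proof (intro equalityI subsetI)
    fix e assume "e \<in> uedges D"
    then obtain x y where e: "e = {x, y}" "x \<in> uverts D" "y \<in> uverts D" "adj D x y"
      using D unfolding simple_ugraph_def adj_def by blast
    then have "{f x, f y} \<in> uedges H" "e = g ` {f x, f y}"
      using adj[of x y] gf by (auto simp: H_def adj_def)
    then show "e \<in> (\<lambda>e. g ` e) ` uedges H" by blast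
  next
    fix e assume "e \<in> (\<lambda>e. g ` e) ` uedges H"
    then obtain d where d: "e = g ` d" "d \<in> uedges U" "d \<subseteq> f ` uverts D"
      by (auto simp: H_def)
    \<comment> \<open>Simplicity of \<open>U\<close> makes the edge an unordered pair, so that
      \<open>adj\<close> captures it.\<close>
    then obtain a b where ab: "d = {a, b}"
      using U unfolding simple_ugraph_def by blast
    then obtain x y where xy: "a = f x" "b = f y" "x \<in> uverts D" "y \<in> uverts D"
      using d by auto
    then have "adj D x y" using adj d ab by (simp add: adj_def)
    then show "e \<in> uedges D" using d ab xy gf by (simp add: adj_def)
  qed
  ultimately show "\<exists>H. ugraph_induced H U \<and> ugraph_iso H D"
    unfolding ugraph_iso_def by blast
qed

lemma ugraph_Free_iff:
  assumes "simple_ugraph U" "\<forall>D\<in>F. simple_ugraph D"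
  shows "U \<in> ugraph_Free F \<longleftrightarrow> (\<forall>D\<in>F. \<not> embeds_in_ugraph D U)"
  using assms embeds_in_ugraph_iff[of U] unfolding ugraph_Free_def by blast

section \<open>Adjacency patterns\<close>

text \<open>The patterns are stated for a bare relation so that they also apply to the symmetric
  closure of an arc relation. No vertex set is mentioned: each of the four vertices lies on an edge
  of the pattern, which places it in the graph.\<close>

definition has_P4 :: "('a \<Rightarrow> 'a \<Rightarrow> bool) \<Rightarrow> bool" where
  "has_P4 E \<longleftrightarrow> (\<exists>a b c d. distinct [a, b, c, d] \<and>
     E a b \<and> E b c \<and> E c d \<and> \<not> E a c \<and> \<not> E b d \<and> \<not> E a d)"

definition has_C4 :: "('a \<Rightarrow> 'a \<Rightarrow> bool) \<Rightarrow> bool" where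
  "has_C4 E \<longleftrightarrow> (\<exists>a b c d. distinct [a, b, c, d] \<and>
     E a b \<and> E b c \<and> E c d \<and> E a d \<and> \<not> E a c \<and> \<not> E b d)"

definition has_2K2 :: "('a \<Rightarrow> 'a \<Rightarrow> bool) \<Rightarrow> bool" where
  "has_2K2 E \<longleftrightarrow> (\<exists>a b c d. distinct [a, b, c, d] \<and>
     E a b \<and> E c d \<and> \<not> E a c \<and> \<not> E a d \<and> \<not> E b c \<and> \<not> E b d)"

lemma simple_ugraph_pairs:
  assumes "finite V" "V \<noteq> {}" "P \<subseteq> V \<times> V" "\<forall>p\<in>P. fst p \<noteq> snd p"
  shows "simple_ugraph \<lparr>uverts = V, uedges = (\<lambda>p. {fst p, snd p}) ` P\<rparr>"
  using assms unfolding simple_ugraph_def by fastforce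

lemma simple_P4: "simple_ugraph P4"
  using simple_ugraph_pairs[of "{0, 1, 2, 3::nat}" "{(0, 1), (1, 2), (2, 3)}"]
  by (simp add: P4_def)

lemma simple_C4: "simple_ugraph C4"
  using simple_ugraph_pairs[of "{0, 1, 2, 3::nat}" "{(0, 1), (1, 2), (2, 3), (3, 0)}"]
  by (simp add: C4_def)

lemma simple_two_K2: "simple_ugraph two_K2"
  using simple_ugraph_pairs[of "{0, 1, 2, 3::nat}" "{(0, 1), (2, 3)}"]
  by (simp add: two_K2_def)

text \<open>Symmetry and irreflexivity of \<open>adj\<close> on both sides reduce the sixteen
  conditions of an embedding to the six unordered pairs.\<close>

lemma embeds_in_ugraph4I:
  assumes verts: "uverts D = {0, 1, 2, 3::nat}"
    and dist: "distinct [a, b, c, d]" and "{a, b, c, d} \<subseteq> uverts U"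
    and "simple_ugraph D" "simple_ugraph U"
    and "adj D 0 1 \<longleftrightarrow> adj U a b" "adj D 0 2 \<longleftrightarrow> adj U a c" "adj D 0 3 \<longleftrightarrow> adj U a d"
      "adj D 1 2 \<longleftrightarrow> adj U b c" "adj D 1 3 \<longleftrightarrow> adj U b d" "adj D 2 3 \<longleftrightarrow> adj U c d"
  shows "embeds_in_ugraph D U"
proof -
  define f where "f = (\<lambda>n::nat. if n = 0 then a else if n = 1 then b else if n = 2 then c else d)"
  have f: "f 0 = a" "f 1 = b" "f (Suc 0) = b" "f 2 = c" "f 3 = d" by (simp_all add: f_def)
  have sym: "adj D x y = adj D y x" "adj U u v = adj U v u" for x y u v
    by (auto dest: adj_sym)
  have irrefl: "\<not> adj D x x" "\<not> adj U u u" for x u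
    using assms(4,5) by (auto dest: simple_ugraph_adjD)
  have "inj_on f (uverts D)" "f ` uverts D \<subseteq> uverts U"
    using assms(2,3) by (auto simp: verts f inj_on_def)
  moreover have "\<forall>x\<in>uverts D. \<forall>y\<in>uverts D. adj D x y \<longleftrightarrow> adj U (f x) (f y)"
    using assms(6-) irrefl by (simp add: verts f) (metis sym)
  ultimately show ?thesis unfolding embeds_in_ugraph_def by blast
qed

lemma embeds_in_ugraph4E:
  assumes "embeds_in_ugraph D U" "uverts D = {0, 1, 2, 3::nat}"
  obtains a b c d where "distinct [a, b, c, d]"
    "adj D 0 1 \<longleftrightarrow> adj U a b" "adj D 0 2 \<longleftrightarrow> adj U a c" "adj D 0 3 \<longleftrightarrow> adj U a d"
    "adj D 1 2 \<longleftrightarrow> adj U b c" "adj D 1 3 \<longleftrightarrow> adj U b d" "adj D 2 3 \<longleftrightarrow> adj U c d"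
proof -
  from assms(1) obtain f where f: "inj_on f (uverts D)"
    "\<And>x y. x \<in> uverts D \<Longrightarrow> y \<in> uverts D \<Longrightarrow> adj D x y \<longleftrightarrow> adj U (f x) (f y)"
    unfolding embeds_in_ugraph_def by blast
  have "distinct [f 0, f 1, f 2, f 3]"
    using f(1) by (simp add: assms(2) inj_on_def)
  then show thesis by (rule that) (rule f(2); simp add: assms(2))+
qed

lemma uverts_P4: "uverts P4 = {0, 1, 2, 3}"
  and uverts_C4: "uverts C4 = {0, 1, 2, 3}"
  and uverts_two_K2: "uverts two_K2 = {0, 1, 2, 3}"
  by (simp_all add: P4_def C4_def two_K2_def)

lemma adj_P4:
  "adj P4 0 1" "\<not> adj P4 0 2" "\<not> adj P4 0 3" "adj P4 1 2" "\<not> adj P4 1 3" "adj P4 2 3"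
  by (simp_all add: adj_def P4_def doubleton_eq_iff)

lemma adj_C4:
  "adj C4 0 1" "\<not> adj C4 0 2" "adj C4 0 3" "adj C4 1 2" "\<not> adj C4 1 3" "adj C4 2 3"
  by (simp_all add: adj_def C4_def doubleton_eq_iff)

lemma adj_two_K2:
  "adj two_K2 0 1" "\<not> adj two_K2 0 2" "\<not> adj two_K2 0 3"
  "\<not> adj two_K2 1 2" "\<not> adj two_K2 1 3" "adj two_K2 2 3"
  by (simp_all add: adj_def two_K2_def doubleton_eq_iff)

lemma embeds_P4_iff:
  assumes U: "simple_ugraph U"
  shows "embeds_in_ugraph P4 U \<longleftrightarrow> has_P4 (adj U)"
proof
  assume "embeds_in_ugraph P4 U"
  then obtain a b c d where "distinct [a, b, c, d]"
    "adj P4 0 1 \<longleftrightarrow> adj U a b" "adj P4 0 2 \<longleftrightarrow> adj U a c" "adj P4 0 3 \<longleftrightarrow> adj U a d"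
    "adj P4 1 2 \<longleftrightarrow> adj U b c" "adj P4 1 3 \<longleftrightarrow> adj U b d" "adj P4 2 3 \<longleftrightarrow> adj U c d"
    by (rule embeds_in_ugraph4E[OF _ uverts_P4])
  then show "has_P4 (adj U)"
    using adj_P4 unfolding has_P4_def by blast
next
  assume "has_P4 (adj U)"
  then obtain a b c d where abcd: "distinct [a, b, c, d]"
    "adj P4 0 1 \<longleftrightarrow> adj U a b" "adj P4 0 2 \<longleftrightarrow> adj U a c" "adj P4 0 3 \<longleftrightarrow> adj U a d"
    "adj P4 1 2 \<longleftrightarrow> adj U b c" "adj P4 1 3 \<longleftrightarrow> adj U b d" "adj P4 2 3 \<longleftrightarrow> adj U c d"
    using adj_P4 unfolding has_P4_def by blast
  then have "{a, b, c, d} \<subseteq> uverts U"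
    using simple_ugraph_adjD[OF U] adj_P4 by blast
  then show "embeds_in_ugraph P4 U"
    using embeds_in_ugraph4I[OF uverts_P4 abcd(1) _ simple_P4 U abcd(2-)] by blast
qed

lemma embeds_C4_iff:
  assumes U: "simple_ugraph U"
  shows "embeds_in_ugraph C4 U \<longleftrightarrow> has_C4 (adj U)"
proof
  assume "embeds_in_ugraph C4 U"
  then obtain a b c d where "distinct [a, b, c, d]"
    "adj C4 0 1 \<longleftrightarrow> adj U a b" "adj C4 0 2 \<longleftrightarrow> adj U a c" "adj C4 0 3 \<longleftrightarrow> adj U a d"
    "adj C4 1 2 \<longleftrightarrow> adj U b c" "adj C4 1 3 \<longleftrightarrow> adj U b d" "adj C4 2 3 \<longleftrightarrow> adj U c d"
    by (rule embeds_in_ugraph4E[OF _ uverts_C4])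
  then show "has_C4 (adj U)"
    using adj_C4 unfolding has_C4_def by blast
next
  assume "has_C4 (adj U)"
  then obtain a b c d where abcd: "distinct [a, b, c, d]"
    "adj C4 0 1 \<longleftrightarrow> adj U a b" "adj C4 0 2 \<longleftrightarrow> adj U a c" "adj C4 0 3 \<longleftrightarrow> adj U a d"
    "adj C4 1 2 \<longleftrightarrow> adj U b c" "adj C4 1 3 \<longleftrightarrow> adj U b d" "adj C4 2 3 \<longleftrightarrow> adj U c d"
    using adj_C4 unfolding has_C4_def by blast
  then have "{a, b, c, d} \<subseteq> uverts U"
    using simple_ugraph_adjD[OF U] adj_C4 by blast
  then show "embeds_in_ugraph C4 U"
    using embeds_in_ugraph4I[OF uverts_C4 abcd(1) _ simple_C4 U abcd(2-)] by blast
qed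

lemma embeds_two_K2_iff:
  assumes U: "simple_ugraph U"
  shows "embeds_in_ugraph two_K2 U \<longleftrightarrow> has_2K2 (adj U)"
proof
  assume "embeds_in_ugraph two_K2 U"
  then obtain a b c d where "distinct [a, b, c, d]"
    "adj two_K2 0 1 \<longleftrightarrow> adj U a b" "adj two_K2 0 2 \<longleftrightarrow> adj U a c" "adj two_K2 0 3 \<longleftrightarrow> adj U a d"
    "adj two_K2 1 2 \<longleftrightarrow> adj U b c" "adj two_K2 1 3 \<longleftrightarrow> adj U b d" "adj two_K2 2 3 \<longleftrightarrow> adj U c d"
    by (rule embeds_in_ugraph4E[OF _ uverts_two_K2])
  then show "has_2K2 (adj U)"
    using adj_two_K2 unfolding has_2K2_def by blast
next
  assume "has_2K2 (adj U)"
  then obtain a b c d where abcd: "distinct [a, b, c, d]"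
    "adj two_K2 0 1 \<longleftrightarrow> adj U a b" "adj two_K2 0 2 \<longleftrightarrow> adj U a c" "adj two_K2 0 3 \<longleftrightarrow> adj U a d"
    "adj two_K2 1 2 \<longleftrightarrow> adj U b c" "adj two_K2 1 3 \<longleftrightarrow> adj U b d" "adj two_K2 2 3 \<longleftrightarrow> adj U c d"
    using adj_two_K2 unfolding has_2K2_def by blast
  then have "{a, b, c, d} \<subseteq> uverts U"
    using simple_ugraph_adjD[OF U] adj_two_K2 by blast
  then show "embeds_in_ugraph two_K2 U"
    using embeds_in_ugraph4I[OF uverts_two_K2 abcd(1) _ simple_two_K2 U abcd(2-)] by blast
qed

section \<open>Forbidden subdigraphs and transitivity\<close>

lemma pair_wf_digraph_iff_subset:
  "pair_wf_digraph G \<longleftrightarrow> parcs G \<subseteq> pverts G \<times> pverts G"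
  unfolding pair_wf_digraph_def subset_eq mem_Times_iff by blast

text \<open>By injectivity the pairwise equivalence becomes a single equation of arc sets. For a
  concrete pattern both images then evaluate to explicit finite sets.\<close>

lemma embeds_in_iff_image:
  assumes "pair_wf_digraph D"
  shows "embeds_in D G \<longleftrightarrow> (\<exists>f. inj_on f (pverts D) \<and> f ` pverts D \<subseteq> pverts G \<and>
     parcs G \<inter> (f ` pverts D) \<times> (f ` pverts D) = map_prod f f ` parcs D)"
proof -
  have sub: "parcs D \<subseteq> pverts D \<times> pverts D"
    using assms by (simp add: pair_wf_digraph_iff_subset)
  have eq: "(\<forall>x\<in>pverts D. \<forall>y\<in>pverts D. (x, y) \<in> parcs D \<longleftrightarrow> (f x, f y) \<in> parcs G) \<longleftrightarrow>
      parcs G \<inter> (f ` pverts D) \<times> (f ` pverts D) = map_prod f f ` parcs D" (is "?L \<longleftrightarrow> ?R")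
    if inj: "inj_on f (pverts D)" for f :: "'a \<Rightarrow> 'b"
  proof
    assume L: ?L
    show ?R
    proof (intro equalityI subsetI)
      fix e assume "e \<in> parcs G \<inter> (f ` pverts D) \<times> (f ` pverts D)"
      then obtain x y where "e = map_prod f f (x, y)" "x \<in> pverts D" "y \<in> pverts D"
        "(f x, f y) \<in> parcs G" by auto
      then show "e \<in> map_prod f f ` parcs D" using L by blast
    next
      fix e assume "e \<in> map_prod f f ` parcs D"
      then obtain x y where "e = (f x, f y)" "(x, y) \<in> parcs D" by auto
      then show "e \<in> parcs G \<inter> (f ` pverts D) \<times> (f ` pverts D)" using L sub by blast
    qed
  next
    assume R: ?R
    show ?L
    proof (intro ballI iffI)
      fix x y assume "(x, y) \<in> parcs D"
      then have "map_prod f f (x, y) \<in> map_prod f f ` parcs D" by (rule imageI)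
      then show "(f x, f y) \<in> parcs G" using R by auto
    next
      fix x y assume xy: "x \<in> pverts D" "y \<in> pverts D" "(f x, f y) \<in> parcs G"
      then have "(f x, f y) \<in> map_prod f f ` parcs D" using R by blast
      then obtain x' y' where "(x', y') \<in> parcs D" "f x = f x'" "f y = f y'" by auto
      then show "(x, y) \<in> parcs D" using inj xy sub by (metis inj_onD mem_Sigma_iff subsetD)
    qed
  qed
  show ?thesis
    unfolding embeds_in_def by (intro ex_cong1 conj_cong refl) (rule eq)
qed

text \<open>A map out of a concrete pattern matters only through its values on the pattern vertices,
  so quantifying over maps amounts to quantifying over vertices. \<open>Suc 0\<close> is the form
  that \<open>One_nat_def\<close> gives to \<open>1\<close>.\<close>

lemma ex_nat_fun2: "(\<exists>f::nat \<Rightarrow> 'a. P (f 0) (f (Suc 0))) \<longleftrightarrow> (\<exists>a b. P a b)"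
proof
  assume "\<exists>a b. P a b"
  then obtain a b where "P a b" by blast
  then show "\<exists>f::nat \<Rightarrow> 'a. P (f 0) (f (Suc 0))"
    by (intro exI[of _ "nth [a, b]"]) simp
qed blast

lemma ex_nat_fun3: "(\<exists>f::nat \<Rightarrow> 'a. P (f 0) (f (Suc 0)) (f 2)) \<longleftrightarrow> (\<exists>a b c. P a b c)"
proof
  assume "\<exists>a b c. P a b c"
  then obtain a b c where "P a b c" by blast
  then show "\<exists>f::nat \<Rightarrow> 'a. P (f 0) (f (Suc 0)) (f 2)"
    by (intro exI[of _ "nth [a, b, c]"]) simp
qed blast

lemma ex_nat_fun4:
  "(\<exists>f::nat \<Rightarrow> 'a. P (f 0) (f (Suc 0)) (f 2) (f 3)) \<longleftrightarrow> (\<exists>a b c d. P a b c d)"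
proof
  assume "\<exists>a b c d. P a b c d"
  then obtain a b c d where "P a b c d" by blast
  then show "\<exists>f::nat \<Rightarrow> 'a. P (f 0) (f (Suc 0)) (f 2) (f 3)"
    by (intro exI[of _ "nth [a, b, c, d]"]) simp
qed blast

lemma inj_on_nats:
  fixes f :: "nat \<Rightarrow> 'a"
  shows "inj_on f {0, Suc 0} \<longleftrightarrow> distinct [f 0, f (Suc 0)]"
    and "inj_on f {0, Suc 0, 2} \<longleftrightarrow> distinct [f 0, f (Suc 0), f 2]"
    and "inj_on f {0, Suc 0, 2, 3} \<longleftrightarrow> distinct [f 0, f (Suc 0), f 2, f 3]"
  by (auto simp: inj_on_insert insert_Diff_if)

section \<open>The forbidden digraphs as arc patterns on named vertices\<close>

lemma wf_forbidden:
  "pair_wf_digraph D1" "pair_wf_digraph D5" "pair_wf_digraph D8" "pair_wf_digraph D12"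
  "pair_wf_digraph two_directed_P2" "pair_wf_digraph bidirected_K2"
  by (simp_all add: pair_wf_digraph_iff_subset D1_def D5_def D8_def D12_def
      two_directed_P2_def bidirected_K2_def)

lemma embeds_K2_iff:
  "embeds_in bidirected_K2 G \<longleftrightarrow> (\<exists>a b. distinct [a, b] \<and> {a, b} \<subseteq> pverts G \<and>
     parcs G \<inter> {a, b} \<times> {a, b} = {(a, b), (b, a)})"
  unfolding ex_nat_fun2[symmetric] embeds_in_iff_image[OF wf_forbidden(6)]
  by (simp only: bidirected_K2_def pair_pre_digraph.simps image_insert image_empty map_prod_simp
      One_nat_def inj_on_nats)

lemma embeds_D1_iff:
  "embeds_in D1 G \<longleftrightarrow> (\<exists>a b c. distinct [a, b, c] \<and> {a, b, c} \<subseteq> pverts G \<and>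
     parcs G \<inter> {a, b, c} \<times> {a, b, c} = {(a, b), (b, c)})"
  unfolding ex_nat_fun3[symmetric] embeds_in_iff_image[OF wf_forbidden(1)]
  by (simp only: D1_def pair_pre_digraph.simps image_insert image_empty map_prod_simp
      One_nat_def inj_on_nats)

lemma embeds_D5_iff:
  "embeds_in D5 G \<longleftrightarrow> (\<exists>a b c. distinct [a, b, c] \<and> {a, b, c} \<subseteq> pverts G \<and>
     parcs G \<inter> {a, b, c} \<times> {a, b, c} = {(a, b), (b, c), (c, a)})"
  unfolding ex_nat_fun3[symmetric] embeds_in_iff_image[OF wf_forbidden(2)]
  by (simp only: D5_def pair_pre_digraph.simps image_insert image_empty map_prod_simp
      One_nat_def inj_on_nats)

lemma embeds_D8_iff:
  "embeds_in D8 G \<longleftrightarrow> (\<exists>a b c d. distinct [a, b, c, d] \<and> {a, b, c, d} \<subseteq> pverts G \<and>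
     parcs G \<inter> {a, b, c, d} \<times> {a, b, c, d} = {(a, b), (c, b), (c, d)})"
  unfolding ex_nat_fun4[symmetric] embeds_in_iff_image[OF wf_forbidden(3)]
  by (simp only: D8_def pair_pre_digraph.simps image_insert image_empty map_prod_simp
      One_nat_def inj_on_nats)

lemma embeds_D12_iff:
  "embeds_in D12 G \<longleftrightarrow> (\<exists>a b c d. distinct [a, b, c, d] \<and> {a, b, c, d} \<subseteq> pverts G \<and>
     parcs G \<inter> {a, b, c, d} \<times> {a, b, c, d} = {(a, c), (a, d), (b, c), (b, d)})"
  unfolding ex_nat_fun4[symmetric] embeds_in_iff_image[OF wf_forbidden(4)]
  by (simp only: D12_def pair_pre_digraph.simps image_insert image_empty map_prod_simp
      One_nat_def inj_on_nats)

lemma embeds_2P2_iff: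
  "embeds_in two_directed_P2 G \<longleftrightarrow> (\<exists>a b c d. distinct [a, b, c, d] \<and> {a, b, c, d} \<subseteq> pverts G \<and>
     parcs G \<inter> {a, b, c, d} \<times> {a, b, c, d} = {(a, b), (c, d)})"
  unfolding ex_nat_fun4[symmetric] embeds_in_iff_image[OF wf_forbidden(5)]
  by (simp only: two_directed_P2_def pair_pre_digraph.simps image_insert image_empty map_prod_simp
      One_nat_def inj_on_nats)

text \<open>Instantiated with the arc set of a copy, this serves as a rewrite rule deciding every
  arc between its vertices.\<close>

lemma restr_eqD:
  assumes "R \<inter> S \<times> S = T" "x \<in> S" "y \<in> S"
  shows "(x, y) \<in> R \<longleftrightarrow> (x, y) \<in> T"
  using assms by blast

lemma adj_un: "adj (un G) u v \<longleftrightarrow> (u, v) \<in> parcs G \<or> (v, u) \<in> parcs G"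
  by (auto simp: adj_def un_def doubleton_eq_iff)

lemma nonempty_digraphD:
  assumes "nonempty_digraph G"
  shows "finite (pverts G)" "pverts G \<noteq> {}"
    "(u, v) \<in> parcs G \<Longrightarrow> u \<in> pverts G \<and> v \<in> pverts G \<and> u \<noteq> v"
proof -
  interpret pair_digraph G using assms by (simp add: nonempty_digraph_def)
  show "finite (pverts G)" by (rule pair_finite_verts)
  show "pverts G \<noteq> {}" using assms by (simp add: nonempty_digraph_def)
  show "(u, v) \<in> parcs G \<Longrightarrow> u \<in> pverts G \<and> v \<in> pverts G \<and> u \<noteq> v"
    using in_arcsD1 in_arcsD2 pair_no_loops by fastforce
qed

lemma simple_un:
  assumes "nonempty_digraph G"
  shows "simple_ugraph (un G)"
  using nonempty_digraphD[OF assms] unfolding simple_ugraph_def un_def by auto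

text \<open>A violation of asymmetry is a pair of opposite arcs; its ends differ because there are
  no loops, and the two arcs are all that two vertices can carry.\<close>

lemma embeds_K2_iff_not_asym:
  assumes G: "nonempty_digraph G"
  shows "embeds_in bidirected_K2 G \<longleftrightarrow> \<not> asym (parcs G)"
proof
  assume "embeds_in bidirected_K2 G"
  then obtain a b where arcs: "parcs G \<inter> {a, b} \<times> {a, b} = {(a, b), (b, a)}"
    unfolding embeds_K2_iff by iprover
  have "(a, b) \<in> parcs G" "(b, a) \<in> parcs G" by (simp_all add: restr_eqD[OF arcs])
  then show "\<not> asym (parcs G)" by (auto dest: asymD)
next
  assume "\<not> asym (parcs G)"
  then obtain a b where ab: "(a, b) \<in> parcs G" "(b, a) \<in> parcs G" by (meson asymI)
  have "parcs G \<inter> {a, b} \<times> {a, b} = {(a, b), (b, a)}"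
    using ab nonempty_digraphD(3)[OF G] by auto
  moreover have "distinct [a, b]" "{a, b} \<subseteq> pverts G"
    using ab nonempty_digraphD(3)[OF G] by auto
  ultimately show "embeds_in bidirected_K2 G" unfolding embeds_K2_iff by iprover
qed

text \<open>If \<open>(a, b)\<close> and \<open>(b, c)\<close> are arcs but \<open>(a, c)\<close> is
  not, asymmetry gives \<open>a\<close> different from \<open>c\<close> and settles every other arc
  except \<open>(c, a)\<close>. Its presence yields \<open>D5\<close>, its absence
  \<open>D1\<close>.\<close>

lemma trans_iff_not_embeds_D1_D5:
  assumes G: "nonempty_digraph G" and asym: "asym (parcs G)"
  shows "trans (parcs G) \<longleftrightarrow> \<not> embeds_in D1 G \<and> \<not> embeds_in D5 G"
proof (intro iffI conjI notI)
  assume tr: "trans (parcs G)" and "embeds_in D1 G"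
  then obtain a b c where d: "distinct [a, b, c]"
    "parcs G \<inter> {a, b, c} \<times> {a, b, c} = {(a, b), (b, c)}"
    unfolding embeds_D1_iff by iprover
  note restr = restr_eqD[OF d(2)]
  have "(a, b) \<in> parcs G" "(b, c) \<in> parcs G" by (simp_all add: restr)
  then have "(a, c) \<in> parcs G" by (rule transD[OF tr])
  then show False using d(1) by (simp add: restr)
next
  assume tr: "trans (parcs G)" and "embeds_in D5 G"
  then obtain a b c where d: "distinct [a, b, c]"
    "parcs G \<inter> {a, b, c} \<times> {a, b, c} = {(a, b), (b, c), (c, a)}"
    unfolding embeds_D5_iff by iprover
  note restr = restr_eqD[OF d(2)]
  have "(a, b) \<in> parcs G" "(b, c) \<in> parcs G" by (simp_all add: restr)
  then have "(a, c) \<in> parcs G" by (rule transD[OF tr])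
  then show False using d(1) by (simp add: restr)
next
  assume no: "\<not> embeds_in D1 G \<and> \<not> embeds_in D5 G"
  show "trans (parcs G)"
  proof (rule transI, rule ccontr)
    fix a b c assume ab: "(a, b) \<in> parcs G" and bc: "(b, c) \<in> parcs G"
      and ac: "(a, c) \<notin> parcs G"
    have verts: "distinct [a, b, c]" "{a, b, c} \<subseteq> pverts G"
      using ab bc ac nonempty_digraphD(3)[OF G] asymD[OF asym] by auto
    have arcs: "(a, b) \<in> parcs G" "(b, a) \<notin> parcs G" "(b, c) \<in> parcs G" "(c, b) \<notin> parcs G"
      "(a, c) \<notin> parcs G" "\<And>x. (x, x) \<notin> parcs G"
      using ab bc ac asymD[OF asym] by blast+
    show False
    proof (cases "(c, a) \<in> parcs G")
      case True
      then have "parcs G \<inter> {a, b, c} \<times> {a, b, c} = {(a, b), (b, c), (c, a)}"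
        using arcs by auto
      then show False using no verts unfolding embeds_D5_iff by iprover
    next
      case False
      then have "parcs G \<inter> {a, b, c} \<times> {a, b, c} = {(a, b), (b, c)}"
        using arcs by auto
      then show False using no verts unfolding embeds_D1_iff by iprover
    qed
  qed
qed

text \<open>In a transitive orientation, consecutive edges of an induced path or cycle
  must be oriented alternately.\<close>

lemma embeds_D8_iff_P4:
  assumes G: "nonempty_digraph G" and asym: "asym (parcs G)" and tr: "trans (parcs G)"
  shows "embeds_in D8 G \<longleftrightarrow> has_P4 (adj (un G))"
proof
  assume "embeds_in D8 G"
  then obtain a b c d where d: "distinct [a, b, c, d]"
    and arcs: "parcs G \<inter> {a, b, c, d} \<times> {a, b, c, d} = {(a, b), (c, b), (c, d)}"
    unfolding embeds_D8_iff by iprover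
  have "adj (un G) a b" "adj (un G) b c" "adj (un G) c d"
    "\<not> adj (un G) a c" "\<not> adj (un G) b d" "\<not> adj (un G) a d"
    using d by (auto simp: adj_un restr_eqD[OF arcs])
  then show "has_P4 (adj (un G))" using d unfolding has_P4_def by blast
next
  have *: "embeds_in D8 G" if d: "distinct [a, b, c, d]"
    and e: "adj (un G) b c" "adj (un G) c d"
    and n: "\<not> adj (un G) a c" "\<not> adj (un G) b d" "\<not> adj (un G) a d"
    and ab: "(a, b) \<in> parcs G" for a b c d
  proof -
    have "(c, b) \<in> parcs G" "(c, d) \<in> parcs G"
      using e n ab transD[OF tr] unfolding adj_un by blast+
    then have "parcs G \<inter> {a, b, c, d} \<times> {a, b, c, d} = {(a, b), (c, b), (c, d)}"
      and "{a, b, c, d} \<subseteq> pverts G"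
      using ab n asymD[OF asym] nonempty_digraphD(3)[OF G] by (auto simp: adj_un)
    then show ?thesis using d unfolding embeds_D8_iff by iprover
  qed
  assume "has_P4 (adj (un G))"
  then obtain a b c d where d: "distinct [a, b, c, d]"
    and e: "adj (un G) a b" "adj (un G) b c" "adj (un G) c d"
    and n: "\<not> adj (un G) a c" "\<not> adj (un G) b d" "\<not> adj (un G) a d"
    unfolding has_P4_def by blast
  show "embeds_in D8 G"
  proof (cases "(a, b) \<in> parcs G")
    case True
    then show ?thesis using * d e n by blast
  next
    case False
    \<comment> \<open>With \<open>(b, a)\<close> an arc, \<open>(c, b)\<close> would force an edge
      between \<open>a\<close> and \<open>c\<close>, and after \<open>(b, c)\<close> the arc
      \<open>(c, d)\<close> would force one between \<open>b\<close> and \<open>d\<close>. So the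
      last edge is \<open>(d, c)\<close>, and \<open>*\<close> applies to the path read
      backwards.\<close>
    then have "(d, c) \<in> parcs G" using e n transD[OF tr] unfolding adj_un by blast
    moreover have "distinct [d, c, b, a]" using d by auto
    ultimately show ?thesis using *[of d c b a] e n by (simp add: adj_un) blast
  qed
qed

lemma embeds_D12_iff_C4:
  assumes G: "nonempty_digraph G" and asym: "asym (parcs G)" and tr: "trans (parcs G)"
  shows "embeds_in D12 G \<longleftrightarrow> has_C4 (adj (un G))"
proof
  assume "embeds_in D12 G"
  then obtain a b c d where d: "distinct [a, b, c, d]"
    and arcs: "parcs G \<inter> {a, b, c, d} \<times> {a, b, c, d} = {(a, c), (a, d), (b, c), (b, d)}"
    unfolding embeds_D12_iff by iprover
  have "adj (un G) a c" "adj (un G) c b" "adj (un G) b d" "adj (un G) a d"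
    "\<not> adj (un G) a b" "\<not> adj (un G) c d"
    using d by (auto simp: adj_un restr_eqD[OF arcs])
  moreover have "distinct [a, c, b, d]" using d by auto
  ultimately show "has_C4 (adj (un G))" unfolding has_C4_def by blast
next
  have *: "embeds_in D12 G" if d: "distinct [a, b, c, d]"
    and e: "adj (un G) b c" "adj (un G) c d" "adj (un G) a d"
    and n: "\<not> adj (un G) a c" "\<not> adj (un G) b d"
    and ab: "(a, b) \<in> parcs G" for a b c d
  proof -
    have "(c, b) \<in> parcs G" "(c, d) \<in> parcs G" "(a, d) \<in> parcs G"
      using e n ab transD[OF tr] unfolding adj_un by blast+
    \<comment> \<open>\<open>D12\<close> lists its two sources first, while the cycle alternates
      sources and sinks; hence the order \<open>a\<close>, \<open>c\<close>, \<open>b\<close>,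
      \<open>d\<close>.\<close>
    then have "parcs G \<inter> {a, c, b, d} \<times> {a, c, b, d} = {(a, b), (a, d), (c, b), (c, d)}"
      and "{a, c, b, d} \<subseteq> pverts G"
      using ab n asymD[OF asym] nonempty_digraphD(3)[OF G] by (auto simp: adj_un)
    moreover have "distinct [a, c, b, d]" using d by auto
    ultimately show ?thesis unfolding embeds_D12_iff by iprover
  qed
  assume "has_C4 (adj (un G))"
  then obtain a b c d where d: "distinct [a, b, c, d]"
    and e: "adj (un G) a b" "adj (un G) b c" "adj (un G) c d" "adj (un G) a d"
    and n: "\<not> adj (un G) a c" "\<not> adj (un G) b d"
    unfolding has_C4_def by blast
  show "embeds_in D12 G"
  proof (cases "(a, b) \<in> parcs G")
    case True
    then show ?thesis using * d e n by blast
  next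
    case False
    then have "(b, a) \<in> parcs G" using e unfolding adj_un by blast
    \<comment> \<open>The same cycle traversed from \<open>b\<close> in the opposite direction
      starts with the arc \<open>(b, a)\<close>.\<close>
    moreover have "distinct [b, a, d, c]" using d by auto
    ultimately show ?thesis using *[of b a d c] e n by (simp add: adj_un) blast
  qed
qed

text \<open>Every orientation of two disjoint edges is a copy of \<open>two_directed_P2\<close>;
  asymmetry keeps an edge from carrying both arcs. Exchanging the ends of either edge reduces the
  four orientations to \<open>*\<close>.\<close>

lemma embeds_2P2_iff_2K2:
  assumes G: "nonempty_digraph G" and asym: "asym (parcs G)"
  shows "embeds_in two_directed_P2 G \<longleftrightarrow> has_2K2 (adj (un G))"
proof
  assume "embeds_in two_directed_P2 G"
  then obtain a b c d where d: "distinct [a, b, c, d]"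
    and arcs: "parcs G \<inter> {a, b, c, d} \<times> {a, b, c, d} = {(a, b), (c, d)}"
    unfolding embeds_2P2_iff by iprover
  have "adj (un G) a b" "adj (un G) c d"
    "\<not> adj (un G) a c" "\<not> adj (un G) a d" "\<not> adj (un G) b c" "\<not> adj (un G) b d"
    using d by (auto simp: adj_un restr_eqD[OF arcs])
  then show "has_2K2 (adj (un G))" using d unfolding has_2K2_def by blast
next
  have *: "embeds_in two_directed_P2 G" if d: "distinct [a, b, c, d]"
    and n: "\<not> adj (un G) a c" "\<not> adj (un G) a d" "\<not> adj (un G) b c" "\<not> adj (un G) b d"
    and "(a, b) \<in> parcs G" "(c, d) \<in> parcs G" for a b c d
  proof -
    have "parcs G \<inter> {a, b, c, d} \<times> {a, b, c, d} = {(a, b), (c, d)}"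
      and "{a, b, c, d} \<subseteq> pverts G"
      using that asymD[OF asym] nonempty_digraphD(3)[OF G] by (auto simp: adj_un)
    then show ?thesis using d unfolding embeds_2P2_iff by iprover
  qed
  assume "has_2K2 (adj (un G))"
  then obtain a b c d where d: "distinct [a, b, c, d]"
    and e: "adj (un G) a b" "adj (un G) c d"
    and n: "\<not> adj (un G) a c" "\<not> adj (un G) a d" "\<not> adj (un G) b c" "\<not> adj (un G) b d"
    unfolding has_2K2_def by blast
  have "distinct [b, a, c, d]" "distinct [a, b, d, c]" "distinct [b, a, d, c]" using d by auto
  then show "embeds_in two_directed_P2 G"
    using *[of a b c d] *[of b a c d] *[of a b d c] *[of b a d c] d e n
    unfolding adj_un[of G a b] adj_un[of G c d] by blast
qed

section \<open>Undirected classes\<close>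

lemma adj_disj_union: "adj (ugraph_disj_union G H) u v \<longleftrightarrow> adj G u v \<or> adj H u v"
  by (simp add: adj_def ugraph_disj_union_def)

lemma adj_join:
  "adj (ugraph_join G H) u v \<longleftrightarrow> adj G u v \<or> adj H u v \<or>
     u \<in> uverts G \<and> v \<in> uverts H \<or> u \<in> uverts H \<and> v \<in> uverts G"
  by (auto simp: adj_def ugraph_join_def doubleton_eq_iff)

lemma adj_point: "\<not> adj (ugraph_point v) a b"
  by (simp add: adj_def ugraph_point_def)

lemma uverts_simps:
  "uverts (ugraph_disj_union G H) = uverts G \<union> uverts H"
  "uverts (ugraph_join G H) = uverts G \<union> uverts H"
  "uverts (ugraph_point v) = {v}"
  by (simp_all add: ugraph_disj_union_def ugraph_join_def ugraph_point_def)

lemma simple_ugraph_iff: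
  "simple_ugraph U \<longleftrightarrow> finite (uverts U) \<and> uverts U \<noteq> {} \<and>
     (\<forall>e\<in>uedges U. \<exists>u v. e = {u, v} \<and> u \<in> uverts U \<and> v \<in> uverts U \<and> u \<noteq> v)"
  unfolding simple_ugraph_def by blast

lemma simple_disj_union:
  assumes "simple_ugraph G" "simple_ugraph H"
  shows "simple_ugraph (ugraph_disj_union G H)"
  using assms unfolding simple_ugraph_iff ugraph_disj_union_def by fastforce

lemma simple_join:
  assumes "simple_ugraph G" "simple_ugraph H" "uverts G \<inter> uverts H = {}"
  shows "simple_ugraph (ugraph_join G H)"
proof -
  have "finite (uverts G \<union> uverts H)" "uverts G \<union> uverts H \<noteq> {}"
    using assms by (auto simp: simple_ugraph_iff)
  moreover have "\<exists>u v. e = {u, v} \<and> u \<in> uverts G \<union> uverts H \<and> v \<in> uverts G \<union> uverts H \<and> u \<noteq> v"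
    if "e \<in> uedges G \<or> e \<in> uedges H \<or> (\<exists>u v. e = {u, v} \<and> u \<in> uverts G \<and> v \<in> uverts H)" for e
    using that
  proof (elim disjE exE)
    assume "e \<in> uedges G"
    then show ?thesis using assms(1) unfolding simple_ugraph_iff by blast
  next
    assume "e \<in> uedges H"
    then show ?thesis using assms(2) unfolding simple_ugraph_iff by blast
  next
    fix u v assume "e = {u, v} \<and> u \<in> uverts G \<and> v \<in> uverts H"
    then show ?thesis using assms(3) by blast
  qed
  ultimately show ?thesis unfolding simple_ugraph_iff ugraph_join_def by auto
qed

lemma simple_point: "simple_ugraph (ugraph_point v)"
  by (simp add: simple_ugraph_def ugraph_point_def)

text \<open>A path is connected: consecutive edges share a vertex, and the parts are disjoint, so
  all three edges lie in the same part.\<close>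

lemma no_P4_disj_union:
  assumes "simple_ugraph G" "simple_ugraph H" "uverts G \<inter> uverts H = {}"
    and "\<not> has_P4 (adj G)" "\<not> has_P4 (adj H)"
  shows "\<not> has_P4 (adj (ugraph_disj_union G H))"
proof
  assume "has_P4 (adj (ugraph_disj_union G H))"
  then obtain a b c d where d: "distinct [a, b, c, d]"
    and e: "adj G a b \<or> adj H a b" "adj G b c \<or> adj H b c" "adj G c d \<or> adj H c d"
    and n: "\<not> adj G a c" "\<not> adj H a c" "\<not> adj G b d" "\<not> adj H b d" "\<not> adj G a d" "\<not> adj H a d"
    unfolding has_P4_def adj_disj_union by blast
  have "adj G a b \<and> adj G b c \<and> adj G c d \<or> adj H a b \<and> adj H b c \<and> adj H c d"
    using e assms(3) simple_ugraph_adjD(1,2)[OF assms(1)] simple_ugraph_adjD(1,2)[OF assms(2)]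
    by (metis disjoint_iff)
  then show False using assms(4,5) d n unfolding has_P4_def by blast
qed

text \<open>The complement of a path on four vertices is again such a path, hence connected, so an
  induced path in a join lies in one of the two parts.\<close>

lemma no_P4_join:
  assumes "simple_ugraph G" "simple_ugraph H" "uverts G \<inter> uverts H = {}"
    and "\<not> has_P4 (adj G)" "\<not> has_P4 (adj H)"
  shows "\<not> has_P4 (adj (ugraph_join G H))"
proof
  let ?J = "ugraph_join G H"
  assume "has_P4 (adj ?J)"
  then obtain a b c d where d: "distinct [a, b, c, d]"
    and e: "adj ?J a b" "adj ?J b c" "adj ?J c d"
    and n: "\<not> adj ?J a c" "\<not> adj ?J b d" "\<not> adj ?J a d"
    unfolding has_P4_def by blast
  have verts: "a \<in> uverts G \<union> uverts H" "b \<in> uverts G \<union> uverts H"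
    "c \<in> uverts G \<union> uverts H" "d \<in> uverts G \<union> uverts H"
    using e simple_ugraph_adjD(1,2)[OF simple_join[OF assms(1-3)]] by (auto simp: uverts_simps)
  have "{a, b, c, d} \<subseteq> uverts G \<or> {a, b, c, d} \<subseteq> uverts H"
    using verts n unfolding adj_join by blast
  then have "has_P4 (adj G) \<or> has_P4 (adj H)"
  proof
    assume "{a, b, c, d} \<subseteq> uverts G"
    then have "adj ?J x y \<longleftrightarrow> adj G x y" if "x \<in> {a, b, c, d}" "y \<in> {a, b, c, d}" for x y
      using that assms(3) simple_ugraph_adjD(1)[OF assms(2)] unfolding adj_join by blast
    then show ?thesis using d e n unfolding has_P4_def by (metis insertCI)
  next
    assume "{a, b, c, d} \<subseteq> uverts H"
    then have "adj ?J x y \<longleftrightarrow> adj H x y" if "x \<in> {a, b, c, d}" "y \<in> {a, b, c, d}" for x y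
      using that assms(3) simple_ugraph_adjD(1)[OF assms(1)] unfolding adj_join by blast
    then show ?thesis using d e n unfolding has_P4_def by (metis insertCI)
  qed
  then show False using assms(4,5) by blast
qed

text \<open>Vertices that are not adjacent in a join lie in the same part. The non-edges of
  \<open>2K2\<close> form a four-cycle, which is connected, so the whole pattern lies in one
  part.\<close>

lemma no_2K2_join:
  assumes "simple_ugraph G" "simple_ugraph H" "uverts G \<inter> uverts H = {}"
    and "\<not> has_2K2 (adj G)" "\<not> has_2K2 (adj H)"
  shows "\<not> has_2K2 (adj (ugraph_join G H))"
proof
  let ?J = "ugraph_join G H"
  assume "has_2K2 (adj ?J)"
  then obtain a b c d where d: "distinct [a, b, c, d]"
    and e: "adj ?J a b" "adj ?J c d"
    and n: "\<not> adj ?J a c" "\<not> adj ?J a d" "\<not> adj ?J b c" "\<not> adj ?J b d"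
    unfolding has_2K2_def by blast
  have verts: "a \<in> uverts G \<union> uverts H" "b \<in> uverts G \<union> uverts H"
    "c \<in> uverts G \<union> uverts H" "d \<in> uverts G \<union> uverts H"
    using e simple_ugraph_adjD(1,2)[OF simple_join[OF assms(1-3)]] by (auto simp: uverts_simps)
  have "{a, b, c, d} \<subseteq> uverts G \<or> {a, b, c, d} \<subseteq> uverts H"
    using verts n unfolding adj_join by blast
  then have "has_2K2 (adj G) \<or> has_2K2 (adj H)"
  proof
    assume "{a, b, c, d} \<subseteq> uverts G"
    then have "adj ?J x y \<longleftrightarrow> adj G x y" if "x \<in> {a, b, c, d}" "y \<in> {a, b, c, d}" for x y
      using that assms(3) simple_ugraph_adjD(1)[OF assms(2)] unfolding adj_join by blast
    then show ?thesis using d e n unfolding has_2K2_def by (metis insertCI)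
  next
    assume "{a, b, c, d} \<subseteq> uverts H"
    then have "adj ?J x y \<longleftrightarrow> adj H x y" if "x \<in> {a, b, c, d}" "y \<in> {a, b, c, d}" for x y
      using that assms(3) simple_ugraph_adjD(1)[OF assms(1)] unfolding adj_join by blast
    then show ?thesis using d e n unfolding has_2K2_def by (metis insertCI)
  qed
  then show False using assms(4,5) by blast
qed

lemma adj_add_isolated: "adj (ugraph_disj_union G (ugraph_point v)) = adj G"
  by (intro ext) (simp add: adj_disj_union adj_point)

lemma no_pattern_point:
  "\<not> has_P4 (adj (ugraph_point v))" "\<not> has_C4 (adj (ugraph_point v))"
  "\<not> has_2K2 (adj (ugraph_point v))"
  by (simp_all add: has_P4_def has_C4_def has_2K2_def adj_point)

text \<open>Simplicity is part of the induction because the union and join steps rely on edges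
  staying within their own part.\<close>

lemma cograph_no_P4:
  assumes "cograph U"
  shows "simple_ugraph U \<and> \<not> has_P4 (adj U)"
  using assms
  by induction
    (simp_all add: simple_point no_pattern_point simple_disj_union simple_join
      no_P4_disj_union no_P4_join)

lemma co_trivially_perfect_imp_cograph:
  assumes "co_trivially_perfect U"
  shows "cograph U"
  using assms by induction (auto intro: cograph.intros simp: uverts_simps)

lemma co_trivially_perfect_no_2K2:
  assumes "co_trivially_perfect U"
  shows "simple_ugraph U \<and> \<not> has_2K2 (adj U)"
  using assms
  by induction
    (simp_all add: simple_point no_pattern_point simple_disj_union simple_join
      no_2K2_join adj_add_isolated)

lemma threshold_imp_co_trivially_perfect:
  assumes "threshold_graph U"
  shows "co_trivially_perfect U"
  using assms by induction (auto intro: co_trivially_perfect.intros simp: uverts_simps)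

text \<open>No vertex of a four-cycle is adjacent to all the others.\<close>

lemma threshold_no_C4:
  assumes "threshold_graph U"
  shows "simple_ugraph U \<and> \<not> has_C4 (adj U)"
  using assms
proof induction
  case (point v)
  then show ?case by (simp add: simple_point no_pattern_point)
next
  case (isolated G v)
  then show ?case by (simp add: simple_disj_union simple_point adj_add_isolated)
next
  case (dominating G v)
  let ?J = "ugraph_join G (ugraph_point v)"
  have simple: "simple_ugraph ?J"
    using dominating by (simp add: simple_join simple_point uverts_simps)
  have "\<not> has_C4 (adj ?J)"
  proof
    assume "has_C4 (adj ?J)"
    then obtain a b c d where d: "distinct [a, b, c, d]"
      and e: "adj ?J a b" "adj ?J b c" "adj ?J c d" "adj ?J a d"
      and n: "\<not> adj ?J a c" "\<not> adj ?J b d"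
      unfolding has_C4_def by blast
    have verts: "a \<in> insert v (uverts G)" "b \<in> insert v (uverts G)"
      "c \<in> insert v (uverts G)" "d \<in> insert v (uverts G)"
      using e simple_ugraph_adjD(1,2)[OF simple] by (auto simp: uverts_simps)
    have "v \<noteq> a" "v \<noteq> b" "v \<noteq> c" "v \<noteq> d"
      using d n verts by (auto simp: adj_join uverts_simps)
    then have "has_C4 (adj G)"
      using d e n unfolding has_C4_def adj_join by (auto simp: uverts_simps adj_point)
    then show False using dominating by simp
  qed
  then show ?case using simple by simp
qed

section \<open>Structure of transitive orientations\<close>

text \<open>Excluding the three patterns makes neighbourhoods nested, so a vertex of maximal degree
  is adjacent to everything except isolated vertices.\<close>

lemma isolated_or_dominating:
  fixes E :: "'a \<Rightarrow> 'a \<Rightarrow> bool"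
  assumes fin: "finite V" and ne: "V \<noteq> {}"
    and E_V: "\<And>u v. E u v \<Longrightarrow> v \<in> V" and sym: "\<And>u v. E u v \<Longrightarrow> E v u" and irrefl: "\<And>u. \<not> E u u"
    and no: "\<not> has_P4 E" "\<not> has_C4 E" "\<not> has_2K2 E"
  shows "\<exists>v\<in>V. (\<forall>w. \<not> E v w) \<or> (\<forall>w\<in>V. w \<noteq> v \<longrightarrow> E v w)"
proof -
  have fin_N: "finite {w. E u w}" for u
    using fin E_V by (auto intro: finite_subset)
  have "Max ((\<lambda>u. card {w. E u w}) ` V) \<in> (\<lambda>u. card {w. E u w}) ` V"
    using fin ne by simp
  then obtain v where v: "v \<in> V" and Max: "Max ((\<lambda>u. card {w. E u w}) ` V) = card {w. E v w}"
    by (rule imageE)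
  have max: "card {w. E u w} \<le> card {w. E v w}" if "u \<in> V" for u
    unfolding Max[symmetric] using fin that by (intro Max_ge) auto
  show ?thesis
  proof (cases "\<forall>w\<in>V. w \<noteq> v \<longrightarrow> E v w")
    case True
    then show ?thesis using v by blast
  next
    case False
    then obtain w where w: "w \<in> V" "w \<noteq> v" "\<not> E v w" by blast
    \<comment> \<open>A non-neighbour \<open>w\<close> of the maximum-degree vertex \<open>v\<close>
      is isolated: a neighbour \<open>x\<close> of \<open>w\<close> would have larger degree than
      \<open>v\<close>.\<close>
    have "\<not> E w x" for x
    proof
      assume wx: "E w x"
      have x: "x \<in> V" "x \<noteq> v" "x \<noteq> w" using wx w E_V sym irrefl by blast+
      have nested: "E x y" if y: "E v y" "y \<noteq> x" for y
      proof (rule ccontr)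
        assume xy: "\<not> E x y"
        have "y \<noteq> v" "y \<noteq> w" using y w irrefl by blast+
        \<comment> \<open>The edges \<open>w x\<close>, \<open>v y\<close> and the non-edges
          \<open>v w\<close>, \<open>x y\<close> are fixed; \<open>x v\<close> and
          \<open>w y\<close> are open. Both present gives \<open>C4\<close>, neither gives
          \<open>2K2\<close>, exactly one gives \<open>P4\<close>. The second ordering serves the
          path \<open>x\<close>, \<open>w\<close>, \<open>y\<close>, \<open>v\<close>.\<close>
        then have dist: "distinct [w, x, v, y]" "distinct [x, w, y, v]"
          using x y w by auto
        have "\<not> E w v" using w sym by blast
        then show False
          using dist wx w(3) y(1) xy no sym[of w x] sym[of v y] sym[of x v]
          unfolding has_P4_def has_C4_def has_2K2_def
          by (cases "E x v"; cases "E w y") blast+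
      qed
      \<comment> \<open>The inclusion is proper because \<open>w\<close> is a neighbour of
        \<open>x\<close> but not of \<open>v\<close>.\<close>
      have "{y. E v y} - {x} \<subset> {y. E x y} - {v}"
        using nested irrefl wx w sym by blast
      then have less: "card ({y. E v y} - {x}) < card ({y. E x y} - {v})"
        using fin_N by (intro psubset_card_mono) auto
      \<comment> \<open>The removed elements \<open>x\<close> and \<open>v\<close> are both present
        or both absent, as \<open>E\<close> is symmetric, so the strict inequality survives putting
        them back.\<close>
      have "card {y. E v y} < card {y. E x y}"
      proof (cases "E v x")
        case True
        then have "x \<in> {y. E v y}" "v \<in> {y. E x y}" using sym by auto
        then show ?thesis using less fin_N by (simp add: card_Diff_singleton)
      next
        case False
        then have "x \<notin> {y. E v y}" "v \<notin> {y. E x y}" using sym by auto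
        then show ?thesis using less by simp
      qed
      then show False using max[OF x(1)] by simp
    qed
    then show ?thesis using w by blast
  qed
qed

text \<open>Finiteness gives a minimal element, and totality on \<open>A\<close> makes it least.
  Applied to the converse relation, the lemma yields a greatest element.\<close>

lemma minimum_of_chain:
  assumes "finite A" "A \<noteq> {}" "asym r" "trans r"
    and total: "\<And>x y. x \<in> A \<Longrightarrow> y \<in> A \<Longrightarrow> x \<noteq> y \<Longrightarrow> (x, y) \<in> r \<or> (y, x) \<in> r"
  shows "\<exists>m\<in>A. \<forall>x\<in>A. x \<noteq> m \<longrightarrow> (m, x) \<in> r"
proof -
  have "\<exists>m\<in>A. \<forall>x\<in>A. x \<noteq> m \<longrightarrow> (x, m) \<notin> r"
    using Finite_Set.bex_min_element[of A "\<lambda>x y. (x, y) \<in> r"] assms(1-4)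
    by (auto intro!: asymp_onI transp_onI dest: asymD transD)
  then show ?thesis using total by blast
qed

text \<open>If the dominating vertex is neither source nor sink, its in-neighbours all precede its
  out-neighbours; having no induced four-cycle, one of the two sets is a chain, and an extreme
  vertex of that chain will do.\<close>

lemma isolated_source_or_sink:
  assumes fin: "finite V" and ne: "V \<noteq> {}" and rV: "r \<subseteq> V \<times> V"
    and asym: "asym r" and tr: "trans r"
    and no: "\<not> has_P4 (\<lambda>u v. (u, v) \<in> r \<or> (v, u) \<in> r)"
      "\<not> has_C4 (\<lambda>u v. (u, v) \<in> r \<or> (v, u) \<in> r)"
      "\<not> has_2K2 (\<lambda>u v. (u, v) \<in> r \<or> (v, u) \<in> r)"
  shows "\<exists>v\<in>V. (\<forall>w. (v, w) \<notin> r \<and> (w, v) \<notin> r) \<or>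
    (\<forall>w\<in>V. w \<noteq> v \<longrightarrow> (v, w) \<in> r) \<or> (\<forall>w\<in>V. w \<noteq> v \<longrightarrow> (w, v) \<in> r)"
proof -
  have irrefl: "(u, u) \<notin> r" for u using asymD[OF asym] by blast
  have "\<exists>v\<in>V. (\<forall>w. \<not> ((v, w) \<in> r \<or> (w, v) \<in> r)) \<or> (\<forall>w\<in>V. w \<noteq> v \<longrightarrow> (v, w) \<in> r \<or> (w, v) \<in> r)"
    using rV irrefl no by (intro isolated_or_dominating[OF fin ne]) blast+
  then consider v where "v \<in> V" "\<forall>w. (v, w) \<notin> r \<and> (w, v) \<notin> r"
    | v where "v \<in> V" "\<And>w. w \<in> V \<Longrightarrow> w \<noteq> v \<Longrightarrow> (v, w) \<in> r \<or> (w, v) \<in> r"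
    by blast
  then show ?thesis
  proof cases
    case 1
    then show ?thesis by blast
  next
    case 2
    define A where "A = {u. (u, v) \<in> r}"
    define B where "B = {w. (v, w) \<in> r}"
    have AB: "w = v \<or> w \<in> A \<or> w \<in> B" if "w \<in> V" for w
      using 2 that by (auto simp: A_def B_def)
    \<comment> \<open>Transitivity through \<open>v\<close>.\<close>
    have A_B: "(a, b) \<in> r" if "a \<in> A" "b \<in> B" for a b
      using that transD[OF tr] by (simp add: A_def B_def)
    have finAB: "finite A" "finite B"
      using fin rV by (auto simp: A_def B_def intro: finite_subset[of _ V])
    show ?thesis
    proof (cases "A = {} \<or> B = {}")
      case True
      then show ?thesis using 2 unfolding A_def B_def by blast
    next
      case False
      have "(\<forall>x\<in>A. \<forall>y\<in>A. x \<noteq> y \<longrightarrow> (x, y) \<in> r \<or> (y, x) \<in> r) \<or>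
          (\<forall>x\<in>B. \<forall>y\<in>B. x \<noteq> y \<longrightarrow> (x, y) \<in> r \<or> (y, x) \<in> r)"
      proof (rule ccontr)
        assume "\<not> ?thesis"
        then obtain a a' b b' where ab: "a \<in> A" "a' \<in> A" "a \<noteq> a'" "(a, a') \<notin> r" "(a', a) \<notin> r"
          "b \<in> B" "b' \<in> B" "b \<noteq> b'" "(b, b') \<notin> r" "(b', b) \<notin> r" by blast
        have arcs: "(a, b) \<in> r" "(a, b') \<in> r" "(a', b) \<in> r" "(a', b') \<in> r"
          using A_B ab by auto
        then have "distinct [a, b, a', b']" using ab irrefl by auto
        then show False using no(2) ab arcs unfolding has_C4_def by blast
      qed
      then show ?thesis
      proof
        assume "\<forall>x\<in>A. \<forall>y\<in>A. x \<noteq> y \<longrightarrow> (x, y) \<in> r \<or> (y, x) \<in> r"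
        then obtain m where m: "m \<in> A" "\<And>x. x \<in> A \<Longrightarrow> x \<noteq> m \<Longrightarrow> (m, x) \<in> r"
          using minimum_of_chain[OF finAB(1) _ asym tr] False by blast
        \<comment> \<open>The least element \<open>m\<close> of \<open>A\<close> precedes the rest
          of \<open>A\<close> by choice, \<open>v\<close> by membership in \<open>A\<close>, and
          \<open>B\<close> by \<open>A_B\<close>.\<close>
        then have "\<forall>w\<in>V. w \<noteq> m \<longrightarrow> (m, w) \<in> r"
          using AB A_B unfolding A_def by blast
        moreover have "m \<in> V" using m rV by (auto simp: A_def)
        ultimately show ?thesis by blast
      next
        assume "\<forall>x\<in>B. \<forall>y\<in>B. x \<noteq> y \<longrightarrow> (x, y) \<in> r \<or> (y, x) \<in> r"
        then obtain m where m: "m \<in> B" "\<And>x. x \<in> B \<Longrightarrow> x \<noteq> m \<Longrightarrow> (x, m) \<in> r"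
          using minimum_of_chain[OF finAB(2), of "r\<inverse>"] asym tr False
          by auto
        then have "\<forall>w\<in>V. w \<noteq> m \<longrightarrow> (w, m) \<in> r"
          using AB A_B unfolding B_def by blast
        moreover have "m \<in> V" using m rV by (auto simp: B_def)
        ultimately show ?thesis by blast
      qed
    qed
  qed
qed

text \<open>Here \<open>E'\<close> is \<open>E\<close> restricted to \<open>S\<close>. Every pattern
  vertex lies on an edge of \<open>E'\<close>, hence in \<open>S\<close>, so the non-edges of the
  pattern carry over to \<open>E\<close> as well.\<close>

lemma no_pattern_mono:
  assumes "\<And>u v. u \<in> S \<Longrightarrow> v \<in> S \<Longrightarrow> E' u v \<longleftrightarrow> E u v" "\<And>u v. E' u v \<Longrightarrow> u \<in> S \<and> v \<in> S"
  shows "has_P4 E' \<Longrightarrow> has_P4 E" "has_C4 E' \<Longrightarrow> has_C4 E" "has_2K2 E' \<Longrightarrow> has_2K2 E"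
proof -
  show "has_P4 E' \<Longrightarrow> has_P4 E"
    unfolding has_P4_def by (elim exE, intro exI) (use assms in blast)
  show "has_C4 E' \<Longrightarrow> has_C4 E"
    unfolding has_C4_def by (elim exE, intro exI) (use assms in blast)
  show "has_2K2 E' \<Longrightarrow> has_2K2 E"
    unfolding has_2K2_def by (elim exE, intro exI) (use assms in blast)
qed

text \<open>Vertex set and arc relation are separate variables so that the induction can delete a
  vertex by restricting both; all hypotheses except nonemptiness pass to restrictions, which is why
  a single vertex is treated apart.\<close>

lemma oriented_thresholdI:
  assumes "finite V" "V \<noteq> {}" "r \<subseteq> V \<times> V" "asym r" "trans r"
    and "\<not> has_P4 (\<lambda>u v. (u, v) \<in> r \<or> (v, u) \<in> r)"
      "\<not> has_C4 (\<lambda>u v. (u, v) \<in> r \<or> (v, u) \<in> r)"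
      "\<not> has_2K2 (\<lambda>u v. (u, v) \<in> r \<or> (v, u) \<in> r)"
  shows "oriented_threshold \<lparr>pverts = V, parcs = r\<rparr>"
  using assms
proof (induction "card V" arbitrary: V r rule: less_induct)
  case (less V r)
  note rV = less.prems(3) and asym = less.prems(4) and tr = less.prems(5)
  have irrefl: "(u, u) \<notin> r" for u using asymD[OF asym] by blast
  obtain v where v: "v \<in> V" and cases: "(\<forall>w. (v, w) \<notin> r \<and> (w, v) \<notin> r) \<or>
      (\<forall>w\<in>V. w \<noteq> v \<longrightarrow> (v, w) \<in> r) \<or> (\<forall>w\<in>V. w \<noteq> v \<longrightarrow> (w, v) \<in> r)"
    using isolated_source_or_sink[OF less.prems] by blast
  show ?case
  proof (cases "V = {v}")
    case True
    then have "r = {}" using rV irrefl by blast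
    then show ?thesis using True oriented_threshold.point[of v] by (simp add: digraph_point_def)
  next
    case False
    define W where "W = V - {v}"
    define s where "s = r \<inter> W \<times> W"
    let ?G = "\<lparr>pverts = W, parcs = s\<rparr>"
    have V: "V = W \<union> {v}" and v_W: "v \<notin> W" using v by (auto simp: W_def)
    have agree: "((u, v) \<in> s \<or> (v, u) \<in> s) = ((u, v) \<in> r \<or> (v, u) \<in> r)"
      if "u \<in> W" "v \<in> W" for u v
      using that by (auto simp: s_def)
    have dom: "u \<in> W \<and> v \<in> W" if "(u, v) \<in> s \<or> (v, u) \<in> s" for u v
      using that by (auto simp: s_def)
    have "card W < card V" unfolding W_def using less.prems(1) v by (rule card_Diff1_less)
    moreover have "finite W" "W \<noteq> {}" using less.prems(1) v False by (auto simp: W_def)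
    moreover have "asym s" "trans s"
      using asymD[OF asym] transD[OF tr] unfolding s_def
      by (blast intro: asymI, blast intro: transI)
    moreover have "\<not> has_P4 (\<lambda>u v. (u, v) \<in> s \<or> (v, u) \<in> s)"
      "\<not> has_C4 (\<lambda>u v. (u, v) \<in> s \<or> (v, u) \<in> s)" "\<not> has_2K2 (\<lambda>u v. (u, v) \<in> s \<or> (v, u) \<in> s)"
      using less.prems(6-8) no_pattern_mono[OF agree dom] by iprover+
    ultimately have G: "oriented_threshold ?G"
      by (intro less.hyps) (auto simp: s_def)
    \<comment> \<open>Splitting off the arcs at \<open>v\<close> brings \<open>r\<close> into the
      shape of the three operations: \<open>Out\<close> and \<open>In\<close> are both empty, or one
      is empty and the other equals \<open>W\<close>.\<close>
    define Out where "Out = {w. (v, w) \<in> r}"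
    define In where "In = {u. (u, v) \<in> r}"
    have r: "r = s \<union> {v} \<times> Out \<union> In \<times> {v}"
    proof (rule set_eqI)
      fix e
      show "e \<in> r \<longleftrightarrow> e \<in> s \<union> {v} \<times> Out \<union> In \<times> {v}"
        using rV by (cases e) (auto simp: s_def W_def Out_def In_def)
    qed
    from cases show ?thesis
    proof (elim disjE)
      assume "\<forall>w. (v, w) \<notin> r \<and> (w, v) \<notin> r"
      then have "Out = {}" "In = {}" by (simp_all add: Out_def In_def)
      then have "r = s" using r by simp
      then show ?thesis
        using oriented_threshold.isolated[OF G, of v] v_W
        by (simp add: V digraph_disj_union_def digraph_point_def)
    next
      assume *: "\<forall>w\<in>V. w \<noteq> v \<longrightarrow> (v, w) \<in> r"
      have "Out = W" using * rV irrefl by (auto simp: Out_def W_def)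
      have "(w, v) \<notin> r" for w
        using * rV irrefl asymD[OF asym] by (metis SigmaD1 subsetD)
      then have "In = {}" by (simp add: In_def)
      then have "r = s \<union> {v} \<times> W" using r \<open>Out = W\<close> by simp
      then show ?thesis
        using oriented_threshold.source[OF G, of v] v_W
        by (simp add: V digraph_order_comp_def digraph_point_def)
    next
      assume *: "\<forall>w\<in>V. w \<noteq> v \<longrightarrow> (w, v) \<in> r"
      have "In = W" using * rV irrefl by (auto simp: In_def W_def)
      have "(v, w) \<notin> r" for w
        using * rV irrefl asymD[OF asym] by (metis SigmaD2 subsetD)
      then have "Out = {}" by (simp add: Out_def)
      then have "r = s \<union> W \<times> {v}" using r \<open>In = W\<close> by simp
      then show ?thesis
        using oriented_threshold.sink[OF G, of v] v_W
        by (simp add: V digraph_order_comp_def digraph_point_def)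
    qed
  qed
qed

text \<open>Sources and sinks both project to dominating vertices. The point is written on the right
  in either case, to match the rule \<open>threshold_graph.dominating\<close>.\<close>

lemma un_operations:
  "un (digraph_point v) = ugraph_point v"
  "un (G \<oplus> digraph_point v) = ugraph_disj_union (un G) (ugraph_point v)"
  "un (G \<oslash> digraph_point v) = ugraph_join (un G) (ugraph_point v)"
  "un (digraph_point v \<oslash> G) = ugraph_join (un G) (ugraph_point v)"
  by (auto simp: un_def digraph_point_def ugraph_point_def digraph_disj_union_def
      digraph_order_comp_def ugraph_disj_union_def ugraph_join_def insert_commute)

text \<open>The arc inclusion is carried along because it turns freshness of \<open>v\<close> into
  the absence of old arcs at \<open>v\<close>, on which asymmetry and transitivity of the extended
  relation rest.\<close>

lemma oriented_threshold_imp: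
  assumes "oriented_threshold G"
  shows "parcs G \<subseteq> pverts G \<times> pverts G \<and> asym (parcs G) \<and> trans (parcs G) \<and>
    threshold_graph (un G)"
  using assms
proof induction
  case (point v)
  show ?case
    unfolding un_operations
    by (simp add: digraph_point_def threshold_graph.point asym_on_def)
next
  case (isolated G v)
  then have "threshold_graph (un (G \<oplus> digraph_point v))"
    unfolding un_operations by (intro threshold_graph.isolated) (simp_all add: un_def)
  then show ?case
    using isolated by (auto simp: digraph_disj_union_def digraph_point_def)
next
  case (sink G v)
  then have "threshold_graph (un (G \<oslash> digraph_point v))"
    unfolding un_operations by (intro threshold_graph.dominating) (simp_all add: un_def)
  moreover have "asym (parcs G \<union> pverts G \<times> {v})"
    using sink asymD[of "parcs G"] by (intro asymI) blast
  moreover have "trans (parcs G \<union> pverts G \<times> {v})"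
    using sink transD[of "parcs G"] by (intro transI) blast
  ultimately show ?case
    using sink by (auto simp: digraph_order_comp_def digraph_point_def)
next
  case (source G v)
  then have "threshold_graph (un (digraph_point v \<oslash> G))"
    unfolding un_operations by (intro threshold_graph.dominating) (simp_all add: un_def)
  moreover have "asym (parcs G \<union> {v} \<times> pverts G)"
    using source asymD[of "parcs G"] by (intro asymI) blast
  moreover have "trans (parcs G \<union> {v} \<times> pverts G)"
    using source transD[of "parcs G"] by (intro transI) blast
  ultimately show ?case
    using source by (auto simp: digraph_order_comp_def digraph_point_def)
qed

text \<open>In the forward direction each pattern is excluded at a different class:
  \<open>P4\<close> for co-graphs, \<open>2K2\<close> for co-trivially perfect graphs,
  \<open>C4\<close> for threshold graphs.\<close>

lemma oriented_threshold_iff: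
  assumes G: "nonempty_digraph G"
  shows "oriented_threshold G \<longleftrightarrow> asym (parcs G) \<and> trans (parcs G) \<and>
    \<not> has_P4 (adj (un G)) \<and> \<not> has_C4 (adj (un G)) \<and> \<not> has_2K2 (adj (un G))"
proof (intro iffI conjI)
  assume "oriented_threshold G"
  note t = oriented_threshold_imp[OF this]
  then have threshold: "threshold_graph (un G)" by simp
  then have co: "co_trivially_perfect (un G)" by (rule threshold_imp_co_trivially_perfect)
  show "asym (parcs G)" "trans (parcs G)" using t by simp_all
  show "\<not> has_P4 (adj (un G))"
    using cograph_no_P4[OF co_trivially_perfect_imp_cograph[OF co]] by simp
  show "\<not> has_C4 (adj (un G))" using threshold_no_C4[OF threshold] by simp
  show "\<not> has_2K2 (adj (un G))" using co_trivially_perfect_no_2K2[OF co] by simp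
next
  assume *: "asym (parcs G) \<and> trans (parcs G) \<and>
    \<not> has_P4 (adj (un G)) \<and> \<not> has_C4 (adj (un G)) \<and> \<not> has_2K2 (adj (un G))"
  have "adj (un G) = (\<lambda>u v. (u, v) \<in> parcs G \<or> (v, u) \<in> parcs G)"
    by (intro ext) (rule adj_un)
  then have "oriented_threshold \<lparr>pverts = pverts G, parcs = parcs G\<rparr>"
    using * nonempty_digraphD[OF G] by (intro oriented_thresholdI) auto
  then show "oriented_threshold G" by (cases G) simp
qed

section \<open>Assembling the equivalences\<close>

lemma oriented_co_trivially_perfect_iff:
  "oriented_co_trivially_perfect G \<longleftrightarrow> oriented_threshold G"
proof
  show "oriented_co_trivially_perfect G \<Longrightarrow> oriented_threshold G"
    by (induction rule: oriented_co_trivially_perfect.induct) (auto intro: oriented_threshold.intros)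
  show "oriented_threshold G \<Longrightarrow> oriented_co_trivially_perfect G"
    by (induction rule: oriented_threshold.induct)
      (auto intro: oriented_co_trivially_perfect.intros)
qed

text \<open>The two notions differ only for \<open>u = w\<close>, where \<open>trans\<close> would
  demand a loop from a pair of opposite arcs; asymmetry excludes such pairs.\<close>

lemma transitive_digraph_iff_trans:
  assumes "asym (parcs G)"
  shows "transitive_digraph G \<longleftrightarrow> trans (parcs G)"
  using asymD[OF assms] unfolding transitive_digraph_def trans_def by blast

theorem theorem4p55:
  fixes G :: "'a pair_pre_digraph"
  assumes "nonempty_digraph G"
  shows
    "(oriented_threshold G \<longleftrightarrow>
        oriented_co_trivially_perfect G)
   \<and> (oriented_threshold G \<longleftrightarrow>
        G \<in> digraph_Free {D1, D5, D8, D12, two_directed_P2, bidirected_K2})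
   \<and> (oriented_threshold G \<longleftrightarrow>
        G \<in> digraph_Free {D1, D5, bidirected_K2} \<and> un G \<in> ugraph_Free {two_K2, C4, P4})
   \<and> (oriented_threshold G \<longleftrightarrow>
        G \<in> digraph_Free {D1, D5, bidirected_K2} \<and> threshold_graph (un G))
   \<and> (oriented_threshold G \<longleftrightarrow>
        G \<in> digraph_Free {D1, D5, D12, bidirected_K2} \<and> un G \<in> ugraph_Free {P4, two_K2})
   \<and> (oriented_threshold G \<longleftrightarrow>
        G \<in> digraph_Free {D1, D5, D12, bidirected_K2} \<and> co_trivially_perfect (un G))
   \<and> (oriented_threshold G \<longleftrightarrow>
        G \<in> digraph_Free {D1, D5, D12, two_directed_P2, bidirected_K2} \<and> un G \<in> ugraph_Free {P4})
   \<and> (oriented_threshold G \<longleftrightarrow>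
        G \<in> digraph_Free {D1, D5, D12, two_directed_P2, bidirected_K2} \<and> cograph (un G))
   \<and> (oriented_threshold G \<longleftrightarrow>
        transitive_digraph G \<and> G \<in> digraph_Free {D8, D12, two_directed_P2, bidirected_K2})"
proof -
  let ?E = "adj (un G)"
  have Free: "G \<in> digraph_Free F \<longleftrightarrow> (\<forall>D\<in>F. \<not> embeds_in D G)"
    if "F \<subseteq> {D1, D5, D8, D12, two_directed_P2, bidirected_K2}" for F
    using that wf_forbidden by (intro digraph_Free_iff[OF assms]) blast
  have uFree: "un G \<in> ugraph_Free F \<longleftrightarrow> (\<forall>D\<in>F. \<not> embeds_in_ugraph D (un G))"
    if "F \<subseteq> {P4, C4, two_K2}" for F
    using that simple_P4 simple_C4 simple_two_K2
    by (intro ugraph_Free_iff[OF simple_un[OF assms]]) blast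
  note embeds_u = embeds_P4_iff[OF simple_un[OF assms]] embeds_C4_iff[OF simple_un[OF assms]]
    embeds_two_K2_iff[OF simple_un[OF assms]]
  note K2 = embeds_K2_iff_not_asym[OF assms]
  note D1_D5 = trans_iff_not_embeds_D1_D5[OF assms]
  note D8 = embeds_D8_iff_P4[OF assms] and D12 = embeds_D12_iff_C4[OF assms]
    and P2 = embeds_2P2_iff_2K2[OF assms] and trans = transitive_digraph_iff_trans[of G]
  note ot = oriented_threshold_iff[OF assms]
  have classes: "threshold_graph (un G)" "co_trivially_perfect (un G)" "cograph (un G)"
    if "oriented_threshold G"
    using oriented_threshold_imp[OF that] threshold_imp_co_trivially_perfect
      co_trivially_perfect_imp_cograph by blast+
  have cograph: "un G \<in> ugraph_Free {P4}" if "cograph (un G)"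
    using cograph_no_P4[OF that] by (simp add: uFree embeds_u)
  have co: "un G \<in> ugraph_Free {P4, two_K2}" if "co_trivially_perfect (un G)"
    using that cograph_no_P4[of "un G"] co_trivially_perfect_imp_cograph[of "un G"]
      co_trivially_perfect_no_2K2[of "un G"] by (simp add: uFree embeds_u)
  have threshold: "un G \<in> ugraph_Free {two_K2, C4, P4}" if "threshold_graph (un G)"
    using that co threshold_imp_co_trivially_perfect[of "un G"] threshold_no_C4[of "un G"]
    by (simp add: uFree embeds_u)
  have 3: "oriented_threshold G \<longleftrightarrow>
      G \<in> digraph_Free {D1, D5, D8, D12, two_directed_P2, bidirected_K2}"
    using ot K2 D1_D5 D8 D12 P2 by (simp add: Free) blast
  have 4: "oriented_threshold G \<longleftrightarrow>
      G \<in> digraph_Free {D1, D5, bidirected_K2} \<and> un G \<in> ugraph_Free {two_K2, C4, P4}"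
    using ot K2 D1_D5 by (simp add: Free uFree embeds_u) blast
  have 6: "oriented_threshold G \<longleftrightarrow>
      G \<in> digraph_Free {D1, D5, D12, bidirected_K2} \<and> un G \<in> ugraph_Free {P4, two_K2}"
    using ot K2 D1_D5 D12 by (simp add: Free uFree embeds_u) blast
  have 8: "oriented_threshold G \<longleftrightarrow>
      G \<in> digraph_Free {D1, D5, D12, two_directed_P2, bidirected_K2} \<and> un G \<in> ugraph_Free {P4}"
    using ot K2 D1_D5 D12 P2 by (simp add: Free uFree embeds_u) blast
  have 10: "oriented_threshold G \<longleftrightarrow>
      transitive_digraph G \<and> G \<in> digraph_Free {D8, D12, two_directed_P2, bidirected_K2}"
    using ot K2 trans D8 D12 P2 by (simp add: Free) blast
  \<comment> \<open>The class versions follow from the pattern versions: an oriented threshold graph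
    supplies the class by \<open>classes\<close>, and the class supplies the
    pattern-freeness.\<close>
  have 5: "oriented_threshold G \<longleftrightarrow>
      G \<in> digraph_Free {D1, D5, bidirected_K2} \<and> threshold_graph (un G)"
    using 4 classes(1) threshold by iprover
  have 7: "oriented_threshold G \<longleftrightarrow>
      G \<in> digraph_Free {D1, D5, D12, bidirected_K2} \<and> co_trivially_perfect (un G)"
    using 6 classes(2) co by iprover
  have 9: "oriented_threshold G \<longleftrightarrow>
      G \<in> digraph_Free {D1, D5, D12, two_directed_P2, bidirected_K2} \<and> cograph (un G)"
    using 8 classes(3) cograph by iprover
  show ?thesis
    by (intro conjI oriented_co_trivially_perfect_iff[symmetric] 3 4 5 6 7 8 9 10)
qed

end
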